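(* Let $N\ge1$ be an integer. For every $x\in\mathbb{R}$, $$|F(x)-F_N(x)|\le\eta_N(x):=\Delta(|x|)+\frac{(2\pi+1)|x|}{2\pi A_N\sqrt{x^4+A_N^4}}\,e^{-A_N^2},$$ where, for $x\ge0$, $$\Delta(x)=\begin{cases}\dfrac{x\,e^{-A_N^2}}{\sqrt\pi\,(A_N^2-x^2/2)\,(1-e^{-2A_N^2})}, & 0\le \frac{x}{\sqrt2}\le\frac34A_N,\\[2mm] \dfrac{4x\,e^{-A_N^2}\left(1+2\sqrt\pi\,e^{-\beta A_N^2}\right)}{\sqrt\pi\,A_N(A_N+x/\sqrt2)\,(1-e^{-2A_N^2})}, & \frac34A_N<\frac{x}{\sqrt2}<\frac54A_N,\\[2mm] \dfrac{x\,e^{-A_N^2}}{\sqrt\pi\,(x^2/2-A_N^2)\,(1-e^{-2A_N^2})}+\dfrac{e^{-\sqrt2A_Nx}}{1-e^{-\sqrt2A_Nx}}, & \frac{x}{\sqrt2}\ge\frac54A_N.\end{cases}$$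
   Context: The Fresnel integral is $F(x):=\frac{e^{-i\pi/4}}{\sqrt\pi}\int_x^\infty e^{it^2}\,dt$ for $x\in\mathbb{R}$ (improper integral). For an integer $N\ge1$ put $A_N:=\sqrt{(N+1/2)\pi}$ and $t_k:=\frac{(k-1/2)\pi}{\sqrt{(N+1/2)\pi}}$, and define $$F_N(x):=\frac{1}{\exp\left(2A_Nxe^{-i\pi/4}\right)+1}+\frac{x}{A_N}e^{i(x^2+\pi/4)}\sum_{k=1}^N\frac{e^{-t_k^2}}{x^2+it_k^2}.$$ The constant $\beta$ is $\beta:=1-\frac{\sqrt2}{2}-\frac{2\sqrt2+1}{16}\approx 0.0536$. *)

theory Defs
  imports "HOL-Analysis.Analysis"
begin

text \<open>
  The integrand \<open>exp (\<i> t\<^sup>2)\<close> is not absolutely integrable on \<open>[x, \<infinity>)\<close>, so the Lebesgue integral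
  of the library cannot be used. The improper integral is the limit of the integrals over \<open>[x, b]\<close>
  (which exists, so \<open>Lim\<close> is never an unspecified value).
\<close>

definition fresnel_F :: "real \<Rightarrow> complex" where
  "fresnel_F x = exp (- \<i> * of_real pi / 4) / of_real (sqrt pi) *
     Lim at_top (\<lambda>b::real. integral {x..b} (\<lambda>t::real. exp (\<i> * of_real (t\<^sup>2))))"

definition A_N :: "nat \<Rightarrow> real" where
  "A_N N = sqrt ((real N + 1/2) * pi)"

definition t_node :: "nat \<Rightarrow> nat \<Rightarrow> real" where
  "t_node N k = (real k - 1/2) * pi / A_N N"

definition fresnel_FN :: "nat \<Rightarrow> real \<Rightarrow> complex" where
  "fresnel_FN N x =
     1 / (exp (2 * of_real (A_N N) * of_real x * exp (- \<i> * of_real pi / 4)) + 1)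
     + of_real (x / A_N N) * exp (\<i> * of_real (x\<^sup>2 + pi / 4)) *
       (\<Sum>k=1..N. of_real (exp (- (t_node N k)\<^sup>2)) / (of_real (x\<^sup>2) + \<i> * of_real ((t_node N k)\<^sup>2)))"

definition fresnel_beta :: real where
  "fresnel_beta = 1 - sqrt 2 / 2 - (2 * sqrt 2 + 1) / 16"

text \<open>Only used for \<open>x \<ge> 0\<close>.\<close>

definition fresnel_Delta :: "nat \<Rightarrow> real \<Rightarrow> real" where
  "fresnel_Delta N x =
     (if x / sqrt 2 \<le> 3/4 * A_N N then
        x * exp (- (A_N N)\<^sup>2) / (sqrt pi * ((A_N N)\<^sup>2 - x\<^sup>2 / 2) * (1 - exp (- 2 * (A_N N)\<^sup>2)))
      else if x / sqrt 2 < 5/4 * A_N N then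
        4 * x * exp (- (A_N N)\<^sup>2) * (1 + 2 * sqrt pi * exp (- fresnel_beta * (A_N N)\<^sup>2))
          / (sqrt pi * A_N N * (A_N N + x / sqrt 2) * (1 - exp (- 2 * (A_N N)\<^sup>2)))
      else
        x * exp (- (A_N N)\<^sup>2) / (sqrt pi * (x\<^sup>2 / 2 - (A_N N)\<^sup>2) * (1 - exp (- 2 * (A_N N)\<^sup>2)))
          + exp (- sqrt 2 * A_N N * x) / (1 - exp (- sqrt 2 * A_N N * x)))"

definition fresnel_eta :: "nat \<Rightarrow> real \<Rightarrow> real" where
  "fresnel_eta N x = fresnel_Delta N \<bar>x\<bar>
     + (2 * pi + 1) * \<bar>x\<bar> / (2 * pi * A_N N * sqrt (x ^ 4 + A_N N ^ 4)) * exp (- (A_N N)\<^sup>2)"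

end

theory Submission
  imports Defs "HOL-Complex_Analysis.Complex_Analysis" "HOL-Probability.Distributions"
    "HOL-Real_Asymp.Real_Asymp"
begin

text \<open>
  Write \<open>A = A_N N\<close>, \<open>h = \<pi> / A\<close> and \<open>y = x / \<surd>2\<close>, and take \<open>x > 0\<close>. The starting point is
  the representation
  \<open>F x = x / (2 \<pi>) * e\<^bsup>i (x\<^sup>2 + \<pi>/4)\<^esup> * \<integral>\<^sub>\<real> k(t) dt\<close> with
  \<open>k(t) = e\<^bsup>- t\<^sup>2\<^esup> / (x\<^sup>2 + i t\<^sup>2)\<close>
  (\<open>fresnel_F_eq_kernel_integral\<close>). The sum in \<open>fresnel_FN\<close> is the midpoint rule with step \<open>h\<close> for
  this integral, truncated after \<open>N\<close> nodes on each side of the origin. Its first summand corrects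
  for the poles \<open>\<plusminus>p\<close>, \<open>p = y + i y\<close>, of the kernel.

  The midpoint rule is a sum of residues. The weight \<open>w(z) = 1 / (1 + e\<^bsup>- 2 i A z\<^esup>)\<close> has its poles
  at the nodes, satisfies \<open>w(-z) = 1 - w(z)\<close> and is of size \<open>e\<^bsup>- 2 A Im z\<^esup>\<close> in the upper half plane.
  Applying the residue theorem to \<open>k w\<close> on a rectangle between heights \<open>-A\<close> and \<open>A\<close>, and to \<open>k\<close>
  between heights \<open>0\<close> and \<open>A\<close>, yields
  \<open>\<integral> k - h \<Sum> k(t\<^sub>j) = 2 \<integral> (k w)(u + i A) du\<close> plus \<open>2 \<pi> e\<^bsup>- p\<^sup>2\<^esup> w(p) / p\<close> when \<open>p\<close> lies below
  height \<open>A\<close> (\<open>midpoint_error_contour\<close>). After multiplication by the prefactor of \<open>F\<close> the pole term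
  is exactly the correction \<open>1 / (e\<^bsup>2 A x e\<^bsup>- i \<pi>/4\<^esup>\<^esup> + 1)\<close>. Height \<open>A\<close> is the best one: there
  \<open>|e\<^bsup>- z\<^sup>2\<^esup> w(z)|\<close> is at most \<open>e\<^bsup>- A\<^sup>2\<^esup> e\<^bsup>- u\<^sup>2\<^esup> / (1 - e\<^bsup>- 2 A\<^sup>2\<^esup>)\<close>, and the Gaussian integrates to
  \<open>\<surd>\<pi>\<close>.

  What is left is the distance from the line to the pole. If \<open>y\<close> is not close to \<open>A\<close>, the product
  of the distances to \<open>p\<close> and \<open>-p\<close> is at least \<open>|A\<^sup>2 - y\<^sup>2|\<close> (\<open>fresnel_error_away\<close>). For \<open>y > A\<close> the
  contour gives no pole term, so the correction itself appears in the error. If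
  \<open>3/4 A < y < 5/4 A\<close>, the line is indented above the pole by a rectangle that stays at distance
  \<open>A/4\<close> from it, at the price of the factor with \<open>fresnel_beta\<close> (\<open>fresnel_error_near\<close>). The case
  \<open>y = A\<close> follows by continuity in \<open>x\<close>. Truncating the node sum gives the last summand of \<open>\<eta>\<close>,
  because the omitted terms are dominated by a geometric series with ratio \<open>e\<^bsup>- 2 \<pi>\<^esup>\<close>
  (\<open>node_tail_sum_le\<close>).

  As \<open>x\<close> tends to \<open>0\<close> from the right, the bound tends to \<open>0\<close>; this gives \<open>F 0 = 1/2\<close> without a
  separate evaluation. Since \<open>F x + F (-x) = 1 = F\<^sub>N x + F\<^sub>N (-x)\<close>, the error at \<open>-x\<close> is the negative
  of the error at \<open>x\<close>.
\<close>

section \<open>The residue theorem on rectangles\<close>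

lemma horizontal_segment_integral:
  assumes "a < b"
  shows "contour_integral (linepath (Complex a c) (Complex b c)) f
    = integral {a..b} (\<lambda>u. f (Complex u c))"
proof -
  have eq: "linepath (Complex a c) (Complex b c) x = Complex (linepath a b x) c" for x
    by (simp add: linepath_def complex_eq_iff algebra_simps)
  have "contour_integral (linepath (Complex a c) (Complex b c)) f
    = integral {0..1} (\<lambda>x. f (Complex (linepath a b x) c)) * of_real (b - a)"
    by (simp add: contour_integral_integral eq mult.commute)
       (simp add: complex_eq_iff Complex_eq)
  also have "integral {0..1} (\<lambda>x. f (Complex (linepath a b x) c))
      = integral {0..(b - a) / (b - a)} (\<lambda>x. f (Complex (a + (b - a) * x) c))"
    using assms by (simp add: algebra_simps linepath_def)
  also have "{0..(b - a) / (b - a)} = (\<lambda>x. x / (b - a)) ` {0..b - a}"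
    using assms by simp
  also have "integral \<dots> (\<lambda>x. f (Complex (a + (b - a) * x) c)) =
             integral {a-a..b-a} (\<lambda>x. f (Complex (x + a) c)) / of_real (b - a)"
    using assms by (subst integral_stretch_real) (auto simp: scaleR_conv_of_real add_ac)
  also have "\<dots> = integral {a..b} (\<lambda>x. f (Complex x c)) / of_real (b - a)"
    by (subst integral_shift_real_ivl) (rule refl)
  finally show ?thesis using assms by simp
qed

text \<open>
  The residue theorem along a rectangle with its four sides written as integrals of a real variable,
  so that symmetries and size estimates can be applied to each side.
\<close>

lemma rectangle_residue:
  fixes f :: "complex \<Rightarrow> complex"
  assumes "a < b" "c < d" and S: "open S" "connected S"
    and sub: "cbox (Complex a c) (Complex b d) \<subseteq> S"
    and P: "finite P" "P \<subseteq> box (Complex a c) (Complex b d)"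
    and hol: "f holomorphic_on S - P"
  shows "integral {a..b} (\<lambda>u. f (Complex u c)) + \<i> * integral {c..d} (\<lambda>v. f (Complex b v))
       - integral {a..b} (\<lambda>u. f (Complex u d)) - \<i> * integral {c..d} (\<lambda>v. f (Complex a v))
       = 2 * of_real pi * \<i> * (\<Sum>p\<in>P. residue f p)"
proof -
  let ?g = "rectpath (Complex a c) (Complex b d)"
  have img: "path_image ?g \<subseteq> S - P"
    using assms path_image_rectpath_cbox_minus_box[of "Complex a c" "Complex b d"] by auto
  have cont: "continuous_on (path_image ?g) f"
    using continuous_on_subset[OF holomorphic_on_imp_continuous_on[OF hol] img] .
  have img_eq: "path_image ?g = closed_segment (Complex a c) (Complex b c)
      \<union> closed_segment (Complex b c) (Complex b d) \<union> closed_segment (Complex b d) (Complex a d)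
      \<union> closed_segment (Complex a d) (Complex a c)"
    by (simp add: rectpath_def Let_def path_image_join Un_assoc)
  have ci: "f contour_integrable_on linepath (Complex a c) (Complex b c)"
    "f contour_integrable_on linepath (Complex b c) (Complex b d)"
    "f contour_integrable_on linepath (Complex b d) (Complex a d)"
    "f contour_integrable_on linepath (Complex a d) (Complex a c)"
    by (rule contour_integrable_continuous_linepath, rule continuous_on_subset[OF cont],
        auto simp: img_eq)+
  have cont_top: "continuous_on (closed_segment (Complex a d) (Complex b d)) f"
    and cont_left: "continuous_on (closed_segment (Complex a c) (Complex a d)) f"
    by (rule continuous_on_subset[OF cont], auto simp: img_eq closed_segment_commute)+
  have h: "contour_integral (linepath (Complex a c) (Complex b c)) f = integral {a..b} (\<lambda>u. f (Complex u c))"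
    using horizontal_segment_integral[OF \<open>a < b\<close>] .
  have t: "contour_integral (linepath (Complex b d) (Complex a d)) f = - integral {a..b} (\<lambda>u. f (Complex u d))"
    using horizontal_segment_integral[OF \<open>a < b\<close>, of d f]
      contour_integral_reverse_linepath[OF cont_top] by (metis minus_minus)
  have r: "contour_integral (linepath (Complex b c) (Complex b d)) f = \<i> * integral {c..d} (\<lambda>v. f (Complex b v))"
    by (rule contour_integral_linepath_same_Re) (use assms in auto)
  have l: "contour_integral (linepath (Complex a d) (Complex a c)) f = - (\<i> * integral {c..d} (\<lambda>v. f (Complex a v)))"
  proof -
    have "contour_integral (linepath (Complex a c) (Complex a d)) f = \<i> * integral {c..d} (\<lambda>v. f (Complex a v))"
      by (rule contour_integral_linepath_same_Re) (use assms in auto)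
    then show ?thesis
      using contour_integral_reverse_linepath[OF cont_left] by (metis minus_minus)
  qed
  have "contour_integral ?g f = contour_integral (linepath (Complex a c) (Complex b c)) f
     + (contour_integral (linepath (Complex b c) (Complex b d)) f
     + (contour_integral (linepath (Complex b d) (Complex a d)) f
     + contour_integral (linepath (Complex a d) (Complex a c)) f))"
    using ci by (simp add: rectpath_def Let_def)
  moreover have "contour_integral ?g f
      = complex_of_real (2 * pi) * \<i> * (\<Sum>p\<in>P. winding_number ?g p * residue f p)"
  proof (rule Residue_theorem[OF S P(1) hol _ _ img])
    show "\<forall>z. z \<notin> S \<longrightarrow> winding_number ?g z = 0"
      using sub assms(1,2) by (auto intro!: winding_number_rectpath_outside)
  qed auto
  moreover have "(\<Sum>p\<in>P. winding_number ?g p * residue f p) = (\<Sum>p\<in>P. residue f p)"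
    using P by (intro sum.cong) (auto simp: winding_number_rectpath subset_iff)
  ultimately show ?thesis by (simp add: h t r l)
qed

section \<open>The kernel, the weight and their residues\<close>

text \<open>
  With \<open>y = x / \<surd>2\<close> this is \<open>e\<^bsup>- z\<^sup>2\<^esup> / (x\<^sup>2 + i z\<^sup>2)\<close>. In terms of \<open>y\<close> the poles are
  \<open>\<plusminus>(y + i y)\<close>, whose height is the quantity compared with \<open>A\<close> everywhere below.
\<close>

definition gauss_kernel :: "real \<Rightarrow> complex \<Rightarrow> complex" where
  "gauss_kernel y z = exp (- z\<^sup>2) / (of_real (2 * y\<^sup>2) + \<i> * z\<^sup>2)"

text \<open>
  Up to a constant this is \<open>1 + i tan (A z)\<close>: a function with simple poles of residue
  \<open>1 / (2 i A)\<close> at the nodes, which decays in the upper half plane and tends to \<open>1\<close> in the lower.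
\<close>

definition midpoint_weight :: "real \<Rightarrow> complex \<Rightarrow> complex" where
  "midpoint_weight A z = 1 / (1 + exp (- 2 * \<i> * of_real A * z))"

text \<open>
  The nodes of the midpoint rule on the whole line, indexed by all integers: nodes \<open>k\<close> and
  \<open>1 - k\<close> are opposite.
\<close>

definition shifted_node :: "real \<Rightarrow> int \<Rightarrow> real" where
  "shifted_node A k = (of_int k - 1/2) * pi / A"

lemma kernel_denominator:
  "of_real (2 * y\<^sup>2) + \<i> * z\<^sup>2 = \<i> * ((z - Complex y y) * (z + Complex y y))"
  by (simp add: Complex_eq power2_eq_square algebra_simps)

lemma kernel_denominator_eq_0_iff:
  "of_real (2 * y\<^sup>2) + \<i> * z\<^sup>2 = 0 \<longleftrightarrow> z = Complex y y \<or> z = - Complex y y"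
  unfolding kernel_denominator by (auto simp: eq_neg_iff_add_eq_0)

lemma gauss_kernel_minus: "gauss_kernel y (- z) = gauss_kernel y z"
  by (simp add: gauss_kernel_def)

lemma norm_gauss_kernel:
  "cmod (gauss_kernel y z)
    = exp ((Im z)\<^sup>2 - (Re z)\<^sup>2) / (cmod (z - Complex y y) * cmod (z + Complex y y))"
  unfolding gauss_kernel_def kernel_denominator norm_divide norm_mult
  by (simp add: power2_eq_square)

lemma gauss_kernel_holomorphic:
  assumes "Complex y y \<notin> S" "- Complex y y \<notin> S"
  shows "gauss_kernel y holomorphic_on S"
  unfolding gauss_kernel_def using assms
  by (intro holomorphic_intros) (auto simp: kernel_denominator_eq_0_iff simp del: of_real_mult)

lemma weight_denominator_eq_0_iff:
  assumes "A > 0"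
  shows "1 + exp (- 2 * \<i> * of_real A * z) = 0 \<longleftrightarrow> (\<exists>k. z = of_real (shifted_node A k))"
proof -
  have "1 + exp (- 2 * \<i> * of_real A * z) = 0 \<longleftrightarrow> exp (- 2 * \<i> * of_real A * z) = exp (\<i> * of_real pi)"
    by (simp add: exp_pi_i' add_eq_0_iff)
  also have "\<dots> \<longleftrightarrow> (\<exists>n::int. - 2 * \<i> * of_real A * z = \<i> * of_real pi + (of_int (2 * n) * pi) * \<i>)"
    by (rule exp_eq)
  also have "\<dots> \<longleftrightarrow> (\<exists>n::int. z = of_real (shifted_node A (- n)))"
  proof (rule ex_cong1)
    fix n :: int
    have "- 2 * \<i> * of_real A * z = \<i> * of_real pi + (of_int (2 * n) * pi) * \<i>
      \<longleftrightarrow> (- 2 * \<i>) * (of_real A * z) = (- 2 * \<i>) * ((of_int (- n) - 1/2) * of_real pi)"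
      by (simp add: algebra_simps)
    also have "\<dots> \<longleftrightarrow> of_real A * z = (of_int (- n) - 1/2) * of_real pi"
      by (subst mult_left_cancel) auto
    also have "\<dots> \<longleftrightarrow> z = of_real (shifted_node A (- n))"
      using assms by (auto simp: shifted_node_def field_simps)
    finally show "- 2 * \<i> * of_real A * z = \<i> * of_real pi + (of_int (2 * n) * pi) * \<i>
      \<longleftrightarrow> z = of_real (shifted_node A (- n))" .
  qed
  also have "\<dots> \<longleftrightarrow> (\<exists>k. z = of_real (shifted_node A k))"
    by (metis minus_minus)
  finally show ?thesis .
qed

text \<open>
  This symmetry folds the lower edge of the rectangle onto the upper one, which is where the factor
  \<open>2\<close> in front of the line integral comes from.
\<close>

lemma midpoint_weight_minus:
  assumes "1 + exp (- 2 * \<i> * of_real A * z) \<noteq> 0"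
  shows "midpoint_weight A (- z) = 1 - midpoint_weight A z"
proof -
  let ?e = "exp (- 2 * \<i> * of_real A * z)"
  have "exp (- 2 * \<i> * of_real A * (- z)) = 1 / ?e"
    by (simp add: exp_minus field_simps)
  then have "midpoint_weight A (- z) = 1 / (1 + 1 / ?e)"
    by (simp add: midpoint_weight_def)
  also have "\<dots> = 1 - 1 / (1 + ?e)"
    using assms exp_not_eq_zero[of "- 2 * \<i> * of_real A * z"]
    by (simp add: divide_simps del: exp_not_eq_zero) (simp add: add.commute)
  finally show ?thesis by (simp add: midpoint_weight_def)
qed

lemma norm_midpoint_weight_le:
  assumes "A > 0" "Im z > 0"
  shows "cmod (midpoint_weight A z) \<le> exp (- 2 * A * Im z) / (1 - exp (- 2 * A * Im z))"
proof -
  let ?E = "exp (2 * A * Im z)"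
  have E: "?E > 1" using assms by simp
  have "?E - 1 = cmod (exp (- 2 * \<i> * of_real A * z)) - cmod 1"
    by simp
  also have "\<dots> \<le> cmod (1 + exp (- 2 * \<i> * of_real A * z))"
    by (metis add.commute norm_diff_ineq)
  finally have "cmod (midpoint_weight A z) \<le> 1 / (?E - 1)"
    using E unfolding midpoint_weight_def norm_divide norm_one
    by (intro divide_left_mono mult_pos_pos) linarith+
  also have "\<dots> = exp (- 2 * A * Im z) / (1 - exp (- 2 * A * Im z))"
    using E by (simp add: exp_minus field_simps)
  finally show ?thesis .
qed

lemma weight_denominator_nonzero:
  assumes "A > 0" "Im z \<noteq> 0"
  shows "1 + exp (- 2 * \<i> * of_real A * z) \<noteq> 0"
  using assms weight_denominator_eq_0_iff[of A z] by auto

lemma residue_gauss_kernel: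
  assumes "y > 0"
  shows "residue (gauss_kernel y) (Complex y y) = exp (- (Complex y y)\<^sup>2) / (2 * \<i> * Complex y y)"
  unfolding gauss_kernel_def
  by (rule residue_simple_pole_deriv[where s = UNIV])
     (use assms in \<open>auto intro!: holomorphic_intros derivative_eq_intros
        simp: kernel_denominator_eq_0_iff simp del: of_real_mult, simp_all add: complex_eq_iff\<close>)

text \<open>
  The weight is holomorphic off the real axis, so near \<open>p\<close> only the denominator of the kernel
  vanishes, and near \<open>-p\<close> likewise. The half plane containing the pole serves as domain for both.
\<close>

lemma residue_kernel_weight_pole:
  assumes "A > 0" "y > 0" and p: "p = Complex y y \<or> p = - Complex y y"
  shows "residue (\<lambda>z. gauss_kernel y z * midpoint_weight A z) p
      = exp (- p\<^sup>2) / (2 * \<i> * p) * midpoint_weight A p"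
proof -
  define S where "S = {z. Im p * Im z > 0}"
  have op: "open S" unfolding S_def by (intro open_Collect_less continuous_intros)
  have "convex S"
  proof -
    have "S = {z. (Im p *\<^sub>R \<i>) \<bullet> z > 0}" by (auto simp: S_def inner_complex_def)
    then show ?thesis by (simp only: convex_halfspace_gt)
  qed
  then have con: "connected S" by (rule convex_connected)
  have pS: "p \<in> S" using p \<open>y > 0\<close> by (auto simp: S_def)
  have nz: "1 + exp (- 2 * \<i> * of_real A * z) \<noteq> 0" if "z \<in> S" for z
    by (rule weight_denominator_nonzero[OF \<open>A > 0\<close>]) (use that in \<open>auto simp: S_def\<close>)
  have "residue (\<lambda>z. (exp (- z\<^sup>2) * midpoint_weight A z) / (of_real (2 * y\<^sup>2) + \<i> * z\<^sup>2)) p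
     = (exp (- p\<^sup>2) * midpoint_weight A p) / (2 * \<i> * p)"
  proof (rule residue_simple_pole_deriv[OF _ _ op con pS])
    show "(\<lambda>z. exp (- z\<^sup>2) * midpoint_weight A z) holomorphic_on S"
      unfolding midpoint_weight_def using nz by (intro holomorphic_intros) auto
    show "((\<lambda>z. of_real (2 * y\<^sup>2) + \<i> * z\<^sup>2) has_field_derivative 2 * \<i> * p) (at p)"
      by (auto intro!: derivative_eq_intros)
    show "exp (- p\<^sup>2) * midpoint_weight A p \<noteq> 0"
      using nz[OF pS] by (simp add: midpoint_weight_def)
    show "2 * \<i> * p \<noteq> 0" using p \<open>y > 0\<close> by (auto simp: complex_eq_iff)
    show "of_real (2 * y\<^sup>2) + \<i> * p\<^sup>2 = 0" using p by (simp only: kernel_denominator_eq_0_iff)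
  qed (intro holomorphic_intros)
  then show ?thesis by (simp add: gauss_kernel_def)
qed

lemma residue_kernel_weight_node:
  assumes "A > 0" "y > 0"
  shows "residue (\<lambda>z. gauss_kernel y z * midpoint_weight A z) (of_real (shifted_node A k))
      = gauss_kernel y (of_real (shifted_node A k)) / (2 * \<i> * of_real A)"
proof -
  define t where "t = complex_of_real (shifted_node A k)"
  define S where "S = {z. Im z < y \<and> Im z > - y}"
  have op: "open S" unfolding S_def
    by (intro open_Collect_conj open_Collect_less continuous_intros)
  have "convex S" unfolding S_def Collect_conj_eq
    by (intro convex_Int convex_halfspace_Im_lt convex_halfspace_Im_gt)
  then have con: "connected S" by (rule convex_connected)
  have tS: "t \<in> S" using \<open>y > 0\<close> by (auto simp: S_def t_def)
  have zero: "1 + exp (- 2 * \<i> * of_real A * t) = 0"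
    using weight_denominator_eq_0_iff[OF \<open>A > 0\<close>] unfolding t_def by blast
  have "residue (\<lambda>z. gauss_kernel y z / (1 + exp (- 2 * \<i> * of_real A * z))) t
      = gauss_kernel y t / (2 * \<i> * of_real A)"
  proof (rule residue_simple_pole_deriv[OF _ _ op con tS])
    show "gauss_kernel y holomorphic_on S"
      by (rule gauss_kernel_holomorphic) (auto simp: S_def)
    have e: "exp (- 2 * \<i> * of_real A * t) = - 1" using zero by (simp add: add_eq_0_iff)
    show "((\<lambda>z. 1 + exp (- 2 * \<i> * of_real A * z)) has_field_derivative 2 * \<i> * of_real A) (at t)"
      by (rule derivative_eq_intros refl)+ (use e in simp)
    show "gauss_kernel y t \<noteq> 0"
      using \<open>y > 0\<close> unfolding gauss_kernel_def
      by (simp add: kernel_denominator_eq_0_iff[simplified]) (auto simp: t_def complex_eq_iff)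
  qed (use zero \<open>A > 0\<close> in \<open>auto intro!: holomorphic_intros\<close>)
  then show ?thesis by (simp add: midpoint_weight_def t_def)
qed

section \<open>The midpoint rule as a contour integral\<close>

lemma Complex_of_real_0: "Complex u 0 = of_real u"
  by (simp add: complex_eq_iff)

lemma shifted_node_inj: "A > 0 \<Longrightarrow> shifted_node A j = shifted_node A k \<longleftrightarrow> j = k"
  by (simp add: shifted_node_def)

lemma continuous_gauss_kernel:
  assumes "continuous_on I g" "\<And>u. u \<in> I \<Longrightarrow> g u \<noteq> Complex y y" "\<And>u. u \<in> I \<Longrightarrow> g u \<noteq> - Complex y y"
  shows "continuous_on I (\<lambda>u. gauss_kernel y (g u))"
proof -
  have "continuous_on (g ` I) (gauss_kernel y)"
    by (rule holomorphic_on_imp_continuous_on, rule gauss_kernel_holomorphic) (use assms in force)+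
  then show ?thesis using assms(1) by (metis continuous_on_compose2 order_refl)
qed

lemma continuous_midpoint_weight:
  assumes "continuous_on I g" "\<And>u. u \<in> I \<Longrightarrow> 1 + exp (- 2 * \<i> * of_real A * g u) \<noteq> 0"
  shows "continuous_on I (\<lambda>u. midpoint_weight A (g u))"
  unfolding midpoint_weight_def using assms by (intro continuous_intros) auto

lemma continuous_Complex [continuous_intros]:
  "continuous_on I f \<Longrightarrow> continuous_on I g \<Longrightarrow> continuous_on I (\<lambda>u. Complex (f u) (g u))"
  unfolding Complex_eq by (intro continuous_intros)

lemma norm_gauss_kernel_side:
  assumes "\<bar>u\<bar> \<ge> y + 1" "y > 0" "\<bar>v\<bar> \<le> A"
  shows "cmod (gauss_kernel y (Complex u v)) \<le> exp (A\<^sup>2 - u\<^sup>2)"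
proof -
  have "1 \<le> cmod (Complex u v - Complex y y)"
    using abs_Re_le_cmod[of "Complex u v - Complex y y"] assms by auto
  moreover have "1 \<le> cmod (Complex u v + Complex y y)"
    using abs_Re_le_cmod[of "Complex u v + Complex y y"] assms by auto
  ultimately have "1 * 1 \<le> cmod (Complex u v - Complex y y) * cmod (Complex u v + Complex y y)"
    by (intro mult_mono) auto
  then have "cmod (gauss_kernel y (Complex u v)) \<le> exp (v\<^sup>2 - u\<^sup>2) / 1"
    unfolding norm_gauss_kernel complex.sel by (intro divide_left_mono) (auto intro!: mult_pos_pos)
  also have "v\<^sup>2 \<le> A\<^sup>2" using assms(3) abs_le_square_iff by fastforce
  then have "exp (v\<^sup>2 - u\<^sup>2) / 1 \<le> exp (A\<^sup>2 - u\<^sup>2)" by simp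
  finally show ?thesis .
qed

text \<open>
  On a vertical line halfway between two nodes \<open>e\<^bsup>- 2 i A z\<^esup>\<close> is real and positive. The vertical sides
  of the rectangles are placed there, so that the weight stays bounded up to the real axis.
\<close>

lemma weight_on_grid_line:
  assumes "A > 0" and u: "u = of_int j * pi / A"
  shows "1 + exp (- 2 * \<i> * of_real A * Complex u v) \<noteq> 0"
    and "cmod (midpoint_weight A (Complex u v)) \<le> 1"
proof -
  have "- 2 * \<i> * of_real A * Complex u v
      = of_real (2 * A * v) + (of_int (2 * (- j)) * pi) * \<i>"
    using \<open>A > 0\<close> by (simp add: complex_eq_iff u)
  then have "exp (- 2 * \<i> * of_real A * Complex u v) = exp (of_real (2 * A * v))"
    using exp_eq by blast
  then have *: "exp (- 2 * \<i> * of_real A * Complex u v) = of_real (exp (2 * A * v))"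
    by (simp only: exp_of_real)
  then have e: "1 + exp (- 2 * \<i> * of_real A * Complex u v) = of_real (1 + exp (2 * A * v))"
    by simp
  have pos: "1 + exp (2 * A * v) > 1" by simp
  show "1 + exp (- 2 * \<i> * of_real A * Complex u v) \<noteq> 0"
    unfolding e of_real_eq_0_iff using pos by (metis not_one_less_zero)
  show "cmod (midpoint_weight A (Complex u v)) \<le> 1"
    unfolding midpoint_weight_def e norm_divide norm_of_real norm_one
    by (subst divide_le_eq_1_pos) (use pos in linarith)+
qed

text \<open>
  The vertical sides of the two rectangles are negligible once they are moved far out.
\<close>

lemma norm_side_integrals_le:
  assumes "A > 0" "y > 0" "\<bar>u\<bar> \<ge> y + 1" and u: "u = of_int j * pi / A"
  shows "cmod (integral {-A..A} (\<lambda>v. gauss_kernel y (Complex u v) * midpoint_weight A (Complex u v)))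
          \<le> 2 * A * exp (A\<^sup>2 - u\<^sup>2)"
    and "cmod (integral {0..A} (\<lambda>v. gauss_kernel y (Complex u v))) \<le> A * exp (A\<^sup>2 - u\<^sup>2)"
proof -
  have "u \<noteq> y" "u \<noteq> - y" using assms(2,3) by auto
  then have cK: "continuous_on I (\<lambda>v. gauss_kernel y (Complex u v))" for I
    by (intro continuous_gauss_kernel) (use \<open>y > 0\<close> in \<open>auto intro!: continuous_intros simp: complex_eq_iff\<close>)
  have cW: "continuous_on I (\<lambda>v. midpoint_weight A (Complex u v))" for I
    by (rule continuous_midpoint_weight)
       (use weight_on_grid_line[OF \<open>A > 0\<close> u] in \<open>auto intro!: continuous_intros\<close>)
  have "cmod (integral {-A..A} (\<lambda>v. gauss_kernel y (Complex u v) * midpoint_weight A (Complex u v)))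
      \<le> exp (A\<^sup>2 - u\<^sup>2) * (A - (- A))"
  proof (rule integral_bound)
    fix v assume "v \<in> {-A..A}"
    then have "cmod (gauss_kernel y (Complex u v)) * cmod (midpoint_weight A (Complex u v))
        \<le> exp (A\<^sup>2 - u\<^sup>2) * 1"
      using assms weight_on_grid_line(2)[OF \<open>A > 0\<close> u]
      by (intro mult_mono norm_gauss_kernel_side) auto
    then show "cmod (gauss_kernel y (Complex u v) * midpoint_weight A (Complex u v)) \<le> exp (A\<^sup>2 - u\<^sup>2)"
      by (simp add: norm_mult)
  qed (use \<open>A > 0\<close> cK cW in \<open>auto intro!: continuous_intros\<close>)
  then show "cmod (integral {-A..A} (\<lambda>v. gauss_kernel y (Complex u v) * midpoint_weight A (Complex u v)))
          \<le> 2 * A * exp (A\<^sup>2 - u\<^sup>2)" by (simp add: algebra_simps)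
  have "cmod (integral {0..A} (\<lambda>v. gauss_kernel y (Complex u v))) \<le> exp (A\<^sup>2 - u\<^sup>2) * (A - 0)"
    by (rule integral_bound) (use assms cK norm_gauss_kernel_side in auto)
  then show "cmod (integral {0..A} (\<lambda>v. gauss_kernel y (Complex u v))) \<le> A * exp (A\<^sup>2 - u\<^sup>2)"
    by (simp add: mult.commute)
qed

text \<open>
  Moving the integral of the kernel alone from the real axis to height \<open>A\<close>. Only \<open>p\<close> can be
  crossed, since \<open>-p\<close> lies in the lower half plane.
\<close>

lemma kernel_shift_identity:
  assumes "A > 0" "y > 0" "y \<noteq> A" "r > y"
  shows "integral {-r..r} (\<lambda>u. gauss_kernel y (of_real u)) + \<i> * integral {0..A} (\<lambda>v. gauss_kernel y (Complex r v))
    - integral {-r..r} (\<lambda>u. gauss_kernel y (Complex u A)) - \<i> * integral {0..A} (\<lambda>v. gauss_kernel y (Complex (-r) v))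
    = (if y < A then of_real pi * exp (- (Complex y y)\<^sup>2) / Complex y y else 0)"
proof -
  define S where "S = {z. Im z > - y} \<inter> {z. Im z < (if y < A then A + 1 else y)}"
  define P where "P = (if y < A then {Complex y y} else {})"
  have "integral {-r..r} (\<lambda>u. gauss_kernel y (Complex u 0)) + \<i> * integral {0..A} (\<lambda>v. gauss_kernel y (Complex r v))
    - integral {-r..r} (\<lambda>u. gauss_kernel y (Complex u A)) - \<i> * integral {0..A} (\<lambda>v. gauss_kernel y (Complex (-r) v))
    = 2 * of_real pi * \<i> * (\<Sum>p\<in>P. residue (gauss_kernel y) p)"
  proof (rule rectangle_residue[where S = S])
    show "open S" unfolding S_def by (intro open_Int open_Collect_less continuous_intros)
    have "convex S" unfolding S_def
      by (intro convex_Int convex_halfspace_Im_lt convex_halfspace_Im_gt)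
    then show "connected S" by (rule convex_connected)
    show "cbox (Complex (- r) 0) (Complex r A) \<subseteq> S"
      using assms by (auto simp: S_def in_cbox_complex_iff)
    show "P \<subseteq> box (Complex (- r) 0) (Complex r A)"
      using assms by (auto simp: P_def in_box_complex_iff)
    show "gauss_kernel y holomorphic_on S - P"
      by (rule gauss_kernel_holomorphic) (use assms in \<open>auto simp: S_def P_def\<close>)
  qed (use assms in \<open>auto simp: P_def\<close>)
  also have "2 * of_real pi * \<i> * (\<Sum>p\<in>P. residue (gauss_kernel y) p)
     = (if y < A then of_real pi * exp (- (Complex y y)\<^sup>2) / Complex y y else 0)"
    using residue_gauss_kernel[OF \<open>y > 0\<close>] by (simp add: P_def)
  finally show ?thesis by (simp add: Complex_of_real_0)
qed

text \<open>
  The rectangle is symmetric about the origin and contains \<open>2 n\<close> nodes; it contains both poles of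
  the kernel or neither. The residues at \<open>p\<close> and \<open>-p\<close> combine to \<open>2 w(p) - 1\<close> by the symmetry of the
  weight.
\<close>

lemma kernel_weight_identity:
  fixes n :: nat
  assumes "A > 0" "y > 0" "y \<noteq> A" and r: "r = real n * pi / A" "r > y"
  defines "F \<equiv> \<lambda>z. gauss_kernel y z * midpoint_weight A z"
    and "p \<equiv> Complex y y"
  shows "integral {-r..r} (\<lambda>u. F (Complex u (-A))) + \<i> * integral {-A..A} (\<lambda>v. F (Complex r v))
    - integral {-r..r} (\<lambda>u. F (Complex u A)) - \<i> * integral {-A..A} (\<lambda>v. F (Complex (-r) v))
    = of_real (pi / A) * (\<Sum>k\<in>{1 - int n..int n}. gauss_kernel y (of_real (shifted_node A k)))
      + (if y < A then of_real pi * exp (- p\<^sup>2) / p * (2 * midpoint_weight A p - 1) else 0)"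
proof -
  define T where "T = (\<lambda>k. complex_of_real (shifted_node A k)) ` {1 - int n..int n}"
  define Q where "Q = (if y < A then {p, - p} else {})"
  \<comment> \<open>Half-height of a neighbourhood of the rectangle: it must avoid the poles of the kernel when they lie outside.\<close>
  define m where "m = (if y < A then A + 1 else y)"
  define S where "S = {z. Re z < r + pi / (2 * A)} \<inter> {z. Re z > - (r + pi / (2 * A))}
      \<inter> ({z. Im z < m} \<inter> {z. Im z > - m})"
  have r0: "r > 0" "pi / (2 * A) > 0" "m > A" using assms by (auto simp: m_def)
  have "integral {-r..r} (\<lambda>u. F (Complex u (-A))) + \<i> * integral {-A..A} (\<lambda>v. F (Complex r v))
    - integral {-r..r} (\<lambda>u. F (Complex u A)) - \<i> * integral {-A..A} (\<lambda>v. F (Complex (-r) v))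
    = 2 * of_real pi * \<i> * (\<Sum>q\<in>T \<union> Q. residue F q)"
  proof (rule rectangle_residue[where S = S])
    show "open S" unfolding S_def by (intro open_Int open_Collect_less continuous_intros)
    have "convex S" unfolding S_def
      by (intro convex_Int convex_halfspace_Im_lt convex_halfspace_Im_gt convex_halfspace_Re_lt convex_halfspace_Re_gt)
    then show "connected S" by (rule convex_connected)
    show "cbox (Complex (- r) (- A)) (Complex r A) \<subseteq> S"
      using r0 by (auto simp: S_def in_cbox_complex_iff)
    have "T \<subseteq> box (Complex (- r) (- A)) (Complex r A)"
    proof
      fix z assume "z \<in> T"
      then obtain k where k: "1 - int n \<le> k" "k \<le> int n" "z = of_real (shifted_node A k)"
        by (auto simp: T_def)
      have "real_of_int k \<le> real n" "1 - real n \<le> real_of_int k" using k by linarith+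
      then have "- real n < real_of_int k - 1/2" "real_of_int k - 1/2 < real n" by linarith+
      then have "- real n * (pi / A) < (real_of_int k - 1/2) * (pi / A)"
        "(real_of_int k - 1/2) * (pi / A) < real n * (pi / A)"
        using \<open>A > 0\<close> by (intro mult_strict_right_mono; simp)+
      then have "- r < shifted_node A k" "shifted_node A k < r"
        by (simp_all add: r shifted_node_def)
      then show "z \<in> box (Complex (- r) (- A)) (Complex r A)"
        using k \<open>A > 0\<close> by (auto simp: in_box_complex_iff)
    qed
    moreover have "Q \<subseteq> box (Complex (- r) (- A)) (Complex r A)"
      using assms by (auto simp: Q_def in_box_complex_iff)
    ultimately show "T \<union> Q \<subseteq> box (Complex (- r) (- A)) (Complex r A)" by blast
    have "gauss_kernel y holomorphic_on S - (T \<union> Q)"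
      by (rule gauss_kernel_holomorphic) (use assms in \<open>auto simp: S_def Q_def m_def\<close>)
    moreover have "1 + exp (- 2 * \<i> * of_real A * z) \<noteq> 0" if z: "z \<in> S - (T \<union> Q)" for z
    proof
      assume "1 + exp (- 2 * \<i> * of_real A * z) = 0"
      then obtain k where k: "z = of_real (shifted_node A k)"
        using weight_denominator_eq_0_iff[OF \<open>A > 0\<close>] by blast
      have "shifted_node A k < r + pi / (2 * A)" "shifted_node A k > - (r + pi / (2 * A))"
        using z k by (auto simp: S_def)
      moreover have "r + pi / (2 * A) = (real n + 1/2) * (pi / A)"
        by (simp add: r algebra_simps)
      ultimately have "(real_of_int k - 1/2) * (pi / A) < (real n + 1/2) * (pi / A)"
        "(- (real n + 1/2)) * (pi / A) < (real_of_int k - 1/2) * (pi / A)"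
        by (simp_all only: shifted_node_def minus_mult_left times_divide_eq_right)
      then have "real_of_int k - 1/2 < real n + 1/2" "- (real n + 1/2) < real_of_int k - 1/2"
        using \<open>A > 0\<close> by (metis mult_right_less_imp_less less_imp_le divide_pos_pos pi_gt_zero)+
      then have "1 - int n \<le> k" "k \<le> int n" by linarith+
      then show False using z k by (auto simp: T_def)
    qed
    ultimately show "F holomorphic_on S - (T \<union> Q)"
      unfolding F_def midpoint_weight_def by (intro holomorphic_intros) auto
  qed (use assms in \<open>auto simp: T_def Q_def\<close>)
  also have "(\<Sum>q\<in>T \<union> Q. residue F q) = (\<Sum>q\<in>T. residue F q) + (\<Sum>q\<in>Q. residue F q)"
    by (rule sum.union_disjoint) (use \<open>y > 0\<close> in \<open>auto simp: T_def Q_def p_def complex_eq_iff\<close>)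
  also have "(\<Sum>q\<in>T. residue F q)
      = (\<Sum>k\<in>{1 - int n..int n}. gauss_kernel y (of_real (shifted_node A k)) / (2 * \<i> * of_real A))"
    unfolding T_def F_def
    by (subst sum.reindex)
       (auto simp: inj_on_def shifted_node_inj[OF \<open>A > 0\<close>] residue_kernel_weight_node[OF \<open>A > 0\<close> \<open>y > 0\<close>])
  also have "\<dots> = (\<Sum>k\<in>{1 - int n..int n}. gauss_kernel y (of_real (shifted_node A k))) / (2 * \<i> * of_real A)"
    by (simp add: sum_divide_distrib)
  also have "(\<Sum>q\<in>Q. residue F q)
      = (if y < A then exp (- p\<^sup>2) / (2 * \<i> * p) * (2 * midpoint_weight A p - 1) else 0)"
  proof (cases "y < A")
    case True
    have "p \<noteq> - p" "p \<noteq> 0" using \<open>y > 0\<close> by (auto simp: p_def complex_eq_iff)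
    moreover have "residue F p = exp (- p\<^sup>2) / (2 * \<i> * p) * midpoint_weight A p"
      unfolding F_def p_def by (rule residue_kernel_weight_pole) (use assms in auto)
    moreover have "residue F (- p) = exp (- (- p)\<^sup>2) / (2 * \<i> * (- p)) * midpoint_weight A (- p)"
      unfolding F_def p_def by (rule residue_kernel_weight_pole) (use assms in auto)
    moreover have "midpoint_weight A (- p) = 1 - midpoint_weight A p"
      by (rule midpoint_weight_minus, rule weight_denominator_nonzero) (use assms in auto)
    ultimately show ?thesis using True by (simp add: Q_def field_simps)
  qed (auto simp: Q_def)
  finally show ?thesis using \<open>A > 0\<close>
    by (simp add: distrib_left)
qed

text \<open>
  Adding the two identities cancels the integral of the kernel at height \<open>A\<close>, and the \<open>- 1\<close> in
  \<open>2 w(p) - 1\<close> cancels the residue of the kernel alone. What remains is twice the weighted integral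
  at height \<open>A\<close>, the pole term, and the four vertical sides, of total length \<open>6 A\<close>.
\<close>

lemma midpoint_error_contour:
  fixes n :: nat
  assumes "A > 0" "y > 0" "y \<noteq> A" and r: "r = real n * pi / A" "r \<ge> y + 1"
  defines "p \<equiv> Complex y y"
  shows "cmod (integral {-r..r} (\<lambda>u. gauss_kernel y (of_real u))
      - of_real (pi / A) * (\<Sum>k\<in>{1 - int n..int n}. gauss_kernel y (of_real (shifted_node A k)))
      - 2 * integral {-r..r} (\<lambda>u. gauss_kernel y (Complex u A) * midpoint_weight A (Complex u A))
      - (if y < A then 2 * of_real pi * exp (- p\<^sup>2) / p * midpoint_weight A p else 0))
    \<le> 6 * A * exp (A\<^sup>2 - r\<^sup>2)"
proof -
  define F where "F = (\<lambda>z. gauss_kernel y z * midpoint_weight A z)"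
  have "r > y" using r by simp
  note id1 = kernel_weight_identity[OF assms(1-3) r(1) \<open>r > y\<close>, folded p_def]
  note id2 = kernel_shift_identity[OF assms(1-3) \<open>r > y\<close>, folded p_def]
  have nz: "1 + exp (- 2 * \<i> * of_real A * Complex u A) \<noteq> 0" for u
    by (rule weight_denominator_nonzero) (use \<open>A > 0\<close> in auto)
  have cK: "continuous_on {-r..r} (\<lambda>u. gauss_kernel y (Complex u A))"
    by (rule continuous_gauss_kernel) (use assms in \<open>auto intro!: continuous_intros simp: complex_eq_iff\<close>)
  have cW: "continuous_on {-r..r} (\<lambda>u. midpoint_weight A (Complex u A))"
    by (rule continuous_midpoint_weight) (use nz in \<open>auto intro!: continuous_intros\<close>)
  have "integral {-r..r} (\<lambda>u. F (Complex u (-A))) = integral {-r..r} (\<lambda>u. F (Complex (- u) (-A)))"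
    using Henstock_Kurzweil_Integration.integral_reflect_real[where a = "- r" and b = r and f = "\<lambda>u. F (Complex u (-A))"] by simp
  also have "\<dots> = integral {-r..r} (\<lambda>u. gauss_kernel y (Complex u A) - F (Complex u A))"
  proof (rule integral_cong)
    fix u
    have "Complex (- u) (- A) = - Complex u A" by (simp add: complex_eq_iff)
    then show "F (Complex (- u) (- A)) = gauss_kernel y (Complex u A) - F (Complex u A)"
      using midpoint_weight_minus[OF nz, of u] by (simp add: F_def gauss_kernel_minus right_diff_distrib)
  qed
  also have "\<dots> = integral {-r..r} (\<lambda>u. gauss_kernel y (Complex u A)) - integral {-r..r} (\<lambda>u. F (Complex u A))"
    unfolding F_def by (intro integral_diff integrable_continuous_real continuous_intros cK cW)
  finally have bottom: "integral {-r..r} (\<lambda>u. F (Complex u (-A)))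
     = integral {-r..r} (\<lambda>u. gauss_kernel y (Complex u A)) - integral {-r..r} (\<lambda>u. F (Complex u A))" .
  have side: "\<bar>r\<bar> \<ge> y + 1" "\<bar>- r\<bar> \<ge> y + 1" "r = of_int (int n) * pi / A"
      "- r = of_int (- int n) * pi / A"
    using r \<open>y > 0\<close> by (simp_all only: of_int_minus of_int_of_nat_eq)
  have B1: "cmod (integral {-A..A} (\<lambda>v. F (Complex r v))) \<le> 2 * A * exp (A\<^sup>2 - r\<^sup>2)"
    and B2: "cmod (integral {0..A} (\<lambda>v. gauss_kernel y (Complex r v))) \<le> A * exp (A\<^sup>2 - r\<^sup>2)"
    unfolding F_def using norm_side_integrals_le[OF assms(1,2) side(1,3)] by auto
  have B3: "cmod (integral {-A..A} (\<lambda>v. F (Complex (- r) v))) \<le> 2 * A * exp (A\<^sup>2 - r\<^sup>2)"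
    and B4: "cmod (integral {0..A} (\<lambda>v. gauss_kernel y (Complex (- r) v))) \<le> A * exp (A\<^sup>2 - r\<^sup>2)"
    unfolding F_def using norm_side_integrals_le[OF assms(1,2) side(2,4)] by auto
  define E where "E = integral {-A..A} (\<lambda>v. F (Complex (- r) v)) - integral {-A..A} (\<lambda>v. F (Complex r v))
     + (integral {0..A} (\<lambda>v. gauss_kernel y (Complex (- r) v)) - integral {0..A} (\<lambda>v. gauss_kernel y (Complex r v)))"
  have "integral {-r..r} (\<lambda>u. gauss_kernel y (of_real u))
      - of_real (pi / A) * (\<Sum>k\<in>{1 - int n..int n}. gauss_kernel y (of_real (shifted_node A k)))
      - 2 * integral {-r..r} (\<lambda>u. F (Complex u A))
      - (if y < A then 2 * of_real pi * exp (- p\<^sup>2) / p * midpoint_weight A p else 0) = \<i> * E"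
  proof -
    \<comment> \<open>The pure algebra of the elimination, with the integrals as indeterminates.\<close>
    have elim: "b - s - 2 * t - c = \<i> * (L - R + (L' - R'))"
      if "(k - t) + \<i> * R - t - \<i> * L = s + c1" "b + \<i> * R' - k - \<i> * L' = c2" "c = c1 + c2"
      for b s t c c1 c2 k L R L' R' :: complex
    proof -
      have e: "s = (k - t) + \<i> * R - t - \<i> * L - c1" "b = c2 - \<i> * R' + k + \<i> * L'"
        unfolding that(1) that(2)[symmetric] by simp_all
      show ?thesis unfolding that(3) e by (simp add: algebra_simps)
    qed
    show ?thesis
      unfolding E_def F_def
      by (rule elim[OF id1[unfolded bottom[unfolded F_def]] id2]) (simp add: algebra_simps diff_divide_distrib)
  qed
  moreover have "cmod (\<i> * E) \<le> (2 * A * exp (A\<^sup>2 - r\<^sup>2) + 2 * A * exp (A\<^sup>2 - r\<^sup>2))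
      + (A * exp (A\<^sup>2 - r\<^sup>2) + A * exp (A\<^sup>2 - r\<^sup>2))"
    unfolding norm_mult norm_ii mult_1 E_def
    by (intro norm_triangle_le norm_triangle_le_diff add_mono B1 B2 B3 B4)
  ultimately show ?thesis by (simp add: F_def)
qed

section \<open>The Fresnel integral as a Gaussian integral\<close>

lemma gaussian_integrable: "integrable lborel (\<lambda>u::real. exp (- u\<^sup>2))"
  and gaussian_has_integral: "((\<lambda>u::real. exp (- u\<^sup>2)) has_integral sqrt pi) UNIV"
proof -
  have "has_bochner_integral lborel (\<lambda>u::real. exp (- u\<^sup>2)) (2 *\<^sub>R (sqrt pi / 2))"
    by (rule has_bochner_integral_even_function[OF gaussian_moment_0]) simp
  then show 1: "integrable lborel (\<lambda>u::real. exp (- u\<^sup>2))"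
    and "((\<lambda>u::real. exp (- u\<^sup>2)) has_integral sqrt pi) UNIV"
    using has_integral_integral_lborel[of "\<lambda>u::real. exp (- u\<^sup>2)"]
    by (auto simp: has_bochner_integral_iff)
qed

lemma gaussian_integral_le: "integral {a..b} (\<lambda>u::real. exp (- u\<^sup>2)) \<le> sqrt pi"
proof -
  have "integral {a..b} (\<lambda>u::real. exp (- u\<^sup>2)) \<le> integral UNIV (\<lambda>u::real. exp (- u\<^sup>2))"
    by (rule integral_subset_le)
       (use gaussian_has_integral in \<open>auto intro!: integrable_continuous_real continuous_intros\<close>)
  then show ?thesis using gaussian_has_integral by (simp add: integral_unique)
qed

lemma symmetric_integral_tendsto:
  fixes f :: "real \<Rightarrow> 'a::banach"
  assumes "(f has_integral i) UNIV"
  shows "((\<lambda>r. integral {-r..r} f) \<longlongrightarrow> i) at_top"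
proof (rule tendstoI)
  fix e :: real assume "e > 0"
  then obtain B where B: "B > 0"
    "\<And>a b. ball 0 B \<subseteq> cbox a b \<Longrightarrow> norm (integral (cbox a b) f - i) < e"
    using assms by (auto simp: has_integral_alt')
  have "dist (integral {-r..r} f) i < e" if "r \<ge> B" for r
  proof -
    have "ball 0 B \<subseteq> cbox (- r) r" using that by (auto simp: abs_if split: if_splits)
    then show ?thesis using B(2) by (simp add: dist_norm)
  qed
  then show "\<forall>\<^sub>F r in at_top. dist (integral {-r..r} f) i < e"
    using eventually_ge_at_top[of B] by (rule eventually_mono[rotated])
qed

lemma kernel_real_nonsing: "y > 0 \<Longrightarrow> of_real u \<noteq> Complex y y" "y > 0 \<Longrightarrow> of_real u \<noteq> - Complex y y"
  by (auto simp: complex_eq_iff)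

lemma norm_gauss_kernel_real:
  assumes "y > 0"
  shows "cmod (gauss_kernel y (of_real u)) \<le> exp (- u\<^sup>2) / (2 * y\<^sup>2)"
proof -
  have "2 * y\<^sup>2 \<le> cmod (Complex (2 * y\<^sup>2) (u\<^sup>2))"
    using complex_Re_le_cmod[of "Complex (2 * y\<^sup>2) (u\<^sup>2)"] by simp
  moreover have "of_real (2 * y\<^sup>2) + \<i> * (of_real u)\<^sup>2 = Complex (2 * y\<^sup>2) (u\<^sup>2)"
    by (simp add: complex_eq_iff flip: of_real_power)
  moreover have "cmod (exp (- (of_real u)\<^sup>2)) = exp (- u\<^sup>2)"
    by (simp flip: of_real_power)
  ultimately show ?thesis
    unfolding gauss_kernel_def norm_divide using assms
    by (metis divide_left_mono exp_ge_zero mult_pos_pos zero_less_numeral zero_less_power less_le_trans)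
qed

lemma continuous_gauss_kernel_real:
  "y > 0 \<Longrightarrow> continuous_on I (\<lambda>u. gauss_kernel y (of_real u))"
  by (rule continuous_gauss_kernel) (auto intro!: continuous_intros simp: kernel_real_nonsing)

lemma gauss_kernel_has_integral:
  assumes "y > 0"
  obtains J where "((\<lambda>u. gauss_kernel y (of_real u)) has_integral J) UNIV"
    "cmod J \<le> sqrt pi / (2 * y\<^sup>2)"
proof -
  have bd: "((\<lambda>u. exp (- u\<^sup>2) / (2 * y\<^sup>2)) has_integral sqrt pi / (2 * y\<^sup>2)) UNIV"
    using gaussian_has_integral by (rule has_integral_divide)
  have "integrable lborel (\<lambda>u. gauss_kernel y (of_real u))"
  proof (rule Bochner_Integration.integrable_bound)
    show "integrable lborel (\<lambda>u. exp (- u\<^sup>2) / (2 * y\<^sup>2))"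
      using gaussian_integrable by simp
    show "(\<lambda>u. gauss_kernel y (of_real u)) \<in> borel_measurable lborel"
      using borel_measurable_continuous_onI[OF continuous_gauss_kernel_real[OF assms]] by simp
    show "AE u in lborel. cmod (gauss_kernel y (of_real u)) \<le> norm (exp (- u\<^sup>2) / (2 * y\<^sup>2))"
      using norm_gauss_kernel_real[OF assms] by (intro AE_I2) (simp add: abs_mult)
  qed
  from has_integral_integral_lborel[OF this]
  have J: "((\<lambda>u. gauss_kernel y (of_real u)) has_integral
      integral\<^sup>L lborel (\<lambda>u. gauss_kernel y (of_real u))) UNIV" .
  moreover have "cmod (integral\<^sup>L lborel (\<lambda>u. gauss_kernel y (of_real u))) \<le> sqrt pi / (2 * y\<^sup>2)"
    using integral_norm_bound_integral[OF has_integral_integrable[OF J] has_integral_integrable[OF bd]]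
      norm_gauss_kernel_real[OF assms] integral_unique[OF J] integral_unique[OF gaussian_has_integral] by simp
  ultimately show ?thesis by (rule that)
qed

lemma stretch_integral:
  fixes f :: "real \<Rightarrow> 'a::banach"
  assumes "x > 0"
  shows "integral {-S..S} (\<lambda>s. f (x * s)) = (1 / x) *\<^sub>R integral {-(x * S)..x * S} f"
proof -
  have "(\<lambda>t. t / x) ` {-(x * S)..x * S} = {-S..S}"
    using assms by simp
  then show ?thesis
    using integral_stretch_real[of x "-(x * S)" "x * S" f] assms by simp
qed

text \<open>
  The function \<open>K(z) = \<integral> e\<^bsup>i z\<^sup>2 (1 + i s\<^sup>2)\<^esup> / (1 + i s\<^sup>2) ds\<close> over \<open>[- S, S]\<close> has derivative
  \<open>2 i z e\<^bsup>i z\<^sup>2\<^esup> \<integral> e\<^bsup>- z\<^sup>2 s\<^sup>2\<^esup> ds\<close>, since the denominator cancels. Substituting \<open>u = x s\<close> turns \<open>K(x)\<close>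
  into the kernel integral and its derivative into the phase \<open>e\<^bsup>i x\<^sup>2\<^esup>\<close> times a truncated Gaussian
  integral. With \<open>S\<close> finite, differentiation under the integral sign is over a compact interval.
\<close>

lemma fresnel_integral_truncated:
  fixes S :: real
  assumes "0 < a" "a \<le> b"
  shows "((\<lambda>x. 2 * \<i> * exp (\<i> * of_real (x\<^sup>2)) * of_real (integral {-(x * S)..x * S} (\<lambda>u. exp (- u\<^sup>2))))
    has_integral
      of_real b * exp (\<i> * of_real (b\<^sup>2)) * integral {-(b * S)..b * S} (\<lambda>u. gauss_kernel (b / sqrt 2) (of_real u))
    - of_real a * exp (\<i> * of_real (a\<^sup>2)) * integral {-(a * S)..a * S} (\<lambda>u. gauss_kernel (a / sqrt 2) (of_real u))) {a..b}"
proof -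
  define d where "d = (\<lambda>s::real. 1 + \<i> * of_real (s\<^sup>2))"
  have d0: "d s \<noteq> 0" for s by (simp add: d_def complex_eq_iff)
  define K where "K = (\<lambda>z. integral {-S..S} (\<lambda>s. exp (\<i> * z\<^sup>2 * d s) / d s))"
  define K' where "K' = (\<lambda>z. integral {-S..S} (\<lambda>s. 2 * \<i> * z * exp (\<i> * z\<^sup>2 * d s)))"
  have cd: "continuous_on I d" for I unfolding d_def by (intro continuous_intros)
  have cd2: "continuous_on I (\<lambda>w. d (snd w))" for I :: "(complex \<times> real) set"
    unfolding d_def by (intro continuous_intros)
  have deriv: "(K has_field_derivative K' z) (at z)" for z
  proof -
    have "((\<lambda>z. integral (cbox (- S) S) (\<lambda>s. exp (\<i> * z\<^sup>2 * d s) / d s)) has_field_derivative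
        integral (cbox (- S) S) (\<lambda>s. 2 * \<i> * z * exp (\<i> * z\<^sup>2 * d s))) (at z within UNIV)"
    proof (rule leibniz_rule_field_derivative)
      fix w s
      show "((\<lambda>z. exp (\<i> * z\<^sup>2 * d s) / d s) has_field_derivative 2 * \<i> * w * exp (\<i> * w\<^sup>2 * d s)) (at w within UNIV)"
        by (auto intro!: derivative_eq_intros simp: d0)
      show "(\<lambda>s. exp (\<i> * w\<^sup>2 * d s) / d s) integrable_on cbox (- S) S"
        by (intro integrable_continuous continuous_intros cd) (simp add: d0)
      show "continuous_on (UNIV \<times> cbox (- S) S) (\<lambda>(z, s). 2 * \<i> * z * exp (\<i> * z\<^sup>2 * d s))"
        by (auto simp: case_prod_unfold intro!: continuous_intros cd2)
    qed auto
    then show ?thesis by (simp add: K_def K'_def cbox_interval del: integral_mult_right)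
  qed
  have K_eq: "K (of_real x) = of_real x * exp (\<i> * of_real (x\<^sup>2))
       * integral {-(x * S)..x * S} (\<lambda>u. gauss_kernel (x / sqrt 2) (of_real u))" if "x > 0" for x
  proof -
    have "exp (\<i> * (of_real x)\<^sup>2 * d s) / d s = of_real (x\<^sup>2) * exp (\<i> * of_real (x\<^sup>2))
         * gauss_kernel (x / sqrt 2) (of_real (x * s))" for s
    proof -
      have "\<i> * (of_real x)\<^sup>2 * d s = \<i> * of_real (x\<^sup>2) - (of_real (x * s))\<^sup>2"
        by (simp add: d_def algebra_simps power2_eq_square)
      moreover have "of_real (2 * (x / sqrt 2)\<^sup>2) + \<i> * (of_real (x * s))\<^sup>2 = of_real (x\<^sup>2) * d s"
        by (simp add: d_def algebra_simps power2_eq_square power_divide)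
      ultimately show ?thesis
        unfolding gauss_kernel_def using that d0[of s]
        by (simp add: exp_diff exp_minus divide_simps)
    qed
    then have "K (of_real x) = integral {-S..S} (\<lambda>s. of_real (x\<^sup>2) * exp (\<i> * of_real (x\<^sup>2))
         * gauss_kernel (x / sqrt 2) (of_real (x * s)))"
      by (simp add: K_def)
    also have "\<dots> = of_real (x\<^sup>2) * exp (\<i> * of_real (x\<^sup>2))
         * integral {-S..S} (\<lambda>s. gauss_kernel (x / sqrt 2) (of_real (x * s)))"
      by (rule integral_mult_right)
    also have "integral {-S..S} (\<lambda>s. gauss_kernel (x / sqrt 2) (of_real (x * s)))
       = (1 / x) *\<^sub>R integral {-(x * S)..x * S} (\<lambda>u. gauss_kernel (x / sqrt 2) (of_real u))"
      using stretch_integral[OF that, of S "\<lambda>u. gauss_kernel (x / sqrt 2) (of_real u)"] by simp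
    finally show ?thesis using that
      by (simp add: scaleR_conv_of_real power2_eq_square field_simps)
  qed
  have K'_eq: "K' (of_real x) = 2 * \<i> * exp (\<i> * of_real (x\<^sup>2))
      * of_real (integral {-(x * S)..x * S} (\<lambda>u. exp (- u\<^sup>2)))" if "x > 0" for x
  proof -
    have "exp (\<i> * (of_real x)\<^sup>2 * d s) = exp (\<i> * of_real (x\<^sup>2)) * of_real (exp (- (x * s)\<^sup>2))" for s
    proof -
      have "\<i> * (of_real x)\<^sup>2 * d s = \<i> * of_real (x\<^sup>2) + of_real (- (x * s)\<^sup>2)"
        by (simp add: d_def algebra_simps power2_eq_square)
      then show ?thesis by (simp only: exp_add exp_of_real)
    qed
    then have "K' (of_real x) = integral {-S..S} (\<lambda>s. 2 * \<i> * of_real x * exp (\<i> * of_real (x\<^sup>2)) * of_real (exp (- (x * s)\<^sup>2)))"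
      by (simp add: K'_def mult.assoc)
    also have "\<dots> = 2 * \<i> * of_real x * exp (\<i> * of_real (x\<^sup>2)) * integral {-S..S} (\<lambda>s. of_real (exp (- (x * s)\<^sup>2)))"
      by (rule integral_mult_right)
    also have "integral {-S..S} (\<lambda>s. complex_of_real (exp (- (x * s)\<^sup>2)))
        = of_real (integral {-S..S} (\<lambda>s. exp (- (x * s)\<^sup>2)))"
    proof -
      have "((\<lambda>s. exp (- (x * s)\<^sup>2)) has_integral integral {-S..S} (\<lambda>s. exp (- (x * s)\<^sup>2))) {-S..S}"
        by (rule integrable_integral) (intro integrable_continuous_real continuous_intros)
      from integral_unique[OF has_integral_of_real[OF this]] show ?thesis .
    qed
    also have "integral {-S..S} (\<lambda>s. exp (- (x * s)\<^sup>2)) = (1 / x) *\<^sub>R integral {-(x * S)..x * S} (\<lambda>u. exp (- u\<^sup>2))"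
      by (rule stretch_integral[OF that])
    finally show ?thesis using that by simp
  qed
  have "((\<lambda>x. K' (of_real x)) has_integral (K (of_real b) - K (of_real a))) {a..b}"
  proof (rule fundamental_theorem_of_calculus[OF \<open>a \<le> b\<close>])
    fix x
    show "((\<lambda>x. K (of_real x)) has_vector_derivative K' (of_real x)) (at x within {a..b})"
      using has_vector_derivative_real_field[OF deriv] by (simp add: o_def)
  qed
  then have "((\<lambda>x. 2 * \<i> * exp (\<i> * of_real (x\<^sup>2)) * of_real (integral {-(x * S)..x * S} (\<lambda>u. exp (- u\<^sup>2))))
      has_integral (K (of_real b) - K (of_real a))) {a..b}"
    by (rule has_integral_eq[rotated]) (rule K'_eq, use assms in auto)
  moreover have "K (of_real b) - K (of_real a)
    = of_real b * exp (\<i> * of_real (b\<^sup>2)) * integral {-(b * S)..b * S} (\<lambda>u. gauss_kernel (b / sqrt 2) (of_real u))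
    - of_real a * exp (\<i> * of_real (a\<^sup>2)) * integral {-(a * S)..a * S} (\<lambda>u. gauss_kernel (a / sqrt 2) (of_real u))"
    using K_eq[of a] K_eq[of b] assms by simp
  ultimately show ?thesis
    by (simp only:)
qed

abbreviation fresnel_phase :: "real \<Rightarrow> complex" where
  "fresnel_phase t \<equiv> exp (\<i> * of_real (t\<^sup>2))"

lemma fresnel_phase_integrable: "fresnel_phase integrable_on {a..b}"
  by (intro integrable_continuous_real continuous_intros)

text \<open>
  The limit of the truncated identity as \<open>S\<close> grows. For \<open>t \<ge> a > 0\<close> the Gaussian integral over
  \<open>[- t S, t S]\<close> misses \<open>\<surd>\<pi>\<close> by no more than the one over \<open>[- a S, a S]\<close>, so convergence is uniform
  on \<open>[a, b]\<close>.
\<close>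

lemma fresnel_integral_proper:
  assumes "0 < a" "a \<le> b"
    and Ja: "((\<lambda>u. gauss_kernel (a / sqrt 2) (of_real u)) has_integral Ja) UNIV"
    and Jb: "((\<lambda>u. gauss_kernel (b / sqrt 2) (of_real u)) has_integral Jb) UNIV"
  shows "2 * \<i> * of_real (sqrt pi) * integral {a..b} fresnel_phase
      = of_real b * fresnel_phase b * Jb - of_real a * fresnel_phase a * Ja"
proof -
  let ?G = "\<lambda>r. integral {-r..r} (\<lambda>u::real. exp (- u\<^sup>2))"
  let ?L = "2 * \<i> * of_real (sqrt pi) * integral {a..b} fresnel_phase"
  define R where "R = (\<lambda>S. of_real b * fresnel_phase b * integral {-(b * S)..b * S} (\<lambda>u. gauss_kernel (b / sqrt 2) (of_real u))
    - of_real a * fresnel_phase a * integral {-(a * S)..a * S} (\<lambda>u. gauss_kernel (a / sqrt 2) (of_real u)))"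
  have "b > 0" using assms by simp
  have top: "filterlim (\<lambda>S. c * S) at_top at_top" if "c > 0" for c :: real
    using that by (rule filterlim_tendsto_pos_mult_at_top[OF tendsto_const _ filterlim_ident])
  have "(R \<longlongrightarrow> of_real b * fresnel_phase b * Jb - of_real a * fresnel_phase a * Ja) at_top"
    unfolding R_def
    by (intro tendsto_intros filterlim_compose[OF symmetric_integral_tendsto[OF Ja] top[OF \<open>a > 0\<close>]]
       filterlim_compose[OF symmetric_integral_tendsto[OF Jb] top[OF \<open>b > 0\<close>]])
  then have lim1: "((\<lambda>S. cmod (?L - R S)) \<longlongrightarrow>
      cmod (?L - (of_real b * fresnel_phase b * Jb - of_real a * fresnel_phase a * Ja))) at_top"
    by (intro tendsto_intros)
  have lim2: "((\<lambda>S. 2 * (sqrt pi - ?G (a * S)) * (b - a)) \<longlongrightarrow> 2 * (sqrt pi - sqrt pi) * (b - a)) at_top"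
    by (intro tendsto_intros filterlim_compose[OF symmetric_integral_tendsto[OF gaussian_has_integral] top[OF \<open>a > 0\<close>]])
  have "cmod (?L - R S) \<le> 2 * (sqrt pi - ?G (a * S)) * (b - a)" if "S \<ge> 0" for S
  proof -
    have 1: "((\<lambda>x. 2 * \<i> * fresnel_phase x * of_real (?G (x * S))) has_integral R S) {a..b}"
      using fresnel_integral_truncated[OF assms(1,2), of S] by (simp add: R_def)
    have 2: "((\<lambda>x. 2 * \<i> * of_real (sqrt pi) * fresnel_phase x) has_integral ?L) {a..b}"
      by (intro has_integral_mult_right integrable_integral fresnel_phase_integrable)
    have 3: "((\<lambda>x. 2 * \<i> * of_real (sqrt pi) * fresnel_phase x - 2 * \<i> * fresnel_phase x * of_real (?G (x * S)))
        has_integral (?L - R S)) (cbox a b)"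
      using has_integral_diff[OF 2 1] by simp
    have "cmod (?L - R S) \<le> 2 * (sqrt pi - ?G (a * S)) * measure lborel (cbox a b)"
    proof (rule has_integral_bound[OF _ 3])
      show "0 \<le> 2 * (sqrt pi - ?G (a * S))" using gaussian_integral_le by simp
      fix x assume x: "x \<in> cbox a b"
      have "a * S \<le> x * S" using x that by (intro mult_right_mono) auto
      then have "?G (a * S) \<le> ?G (x * S)"
        by (intro integral_subset_le) (auto intro!: integrable_continuous_real continuous_intros)
      moreover have "2 * \<i> * of_real (sqrt pi) * fresnel_phase x - 2 * \<i> * fresnel_phase x * of_real (?G (x * S))
          = 2 * \<i> * fresnel_phase x * of_real (sqrt pi - ?G (x * S))"
        by (simp add: algebra_simps)
      then have "cmod (2 * \<i> * of_real (sqrt pi) * fresnel_phase x - 2 * \<i> * fresnel_phase x * of_real (?G (x * S)))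
          = 2 * (sqrt pi - ?G (x * S))"
        using gaussian_integral_le[of "-(x * S)" "x * S"]
        by (simp only: norm_mult norm_of_real) (simp add: norm_exp_i_times del: of_real_power)
      ultimately show "cmod (2 * \<i> * of_real (sqrt pi) * fresnel_phase x - 2 * \<i> * fresnel_phase x * of_real (?G (x * S)))
          \<le> 2 * (sqrt pi - ?G (a * S))" by simp
    qed
    then show ?thesis using \<open>a \<le> b\<close> by simp
  qed
  then have "cmod (?L - (of_real b * fresnel_phase b * Jb - of_real a * fresnel_phase a * Ja))
      \<le> 2 * (sqrt pi - sqrt pi) * (b - a)"
    by (intro tendsto_le[OF trivial_limit_at_top_linorder lim2 lim1] eventually_mono[OF eventually_ge_at_top[of 0]])
  then show ?thesis by simp
qed

text \<open>
  The boundary term at \<open>b\<close> is at most \<open>\<surd>\<pi> / b\<close>. Hence the improper integral converges and only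
  the boundary term at \<open>x\<close> survives.
\<close>

lemma fresnel_integral_limit:
  assumes "x > 0"
    and J: "((\<lambda>u. gauss_kernel (x / sqrt 2) (of_real u)) has_integral J) UNIV"
  shows "((\<lambda>b. integral {x..b} fresnel_phase) \<longlongrightarrow>
      \<i> * of_real x * fresnel_phase x * J / (2 * of_real (sqrt pi))) at_top"
proof -
  have "\<forall>b. \<exists>J. b > 0 \<longrightarrow> ((\<lambda>u. gauss_kernel (b / sqrt 2) (of_real u)) has_integral J) UNIV
      \<and> cmod J \<le> sqrt pi / (2 * (b / sqrt 2)\<^sup>2)"
    using gauss_kernel_has_integral by (metis divide_pos_pos real_sqrt_gt_zero zero_less_numeral)
  then obtain I where I: "b > 0 \<Longrightarrow> ((\<lambda>u. gauss_kernel (b / sqrt 2) (of_real u)) has_integral I b) UNIV"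
      "b > 0 \<Longrightarrow> cmod (I b) \<le> sqrt pi / (2 * (b / sqrt 2)\<^sup>2)" for b :: real
    by metis
  have "((\<lambda>b. of_real b * fresnel_phase b * I b) \<longlongrightarrow> 0) at_top"
  proof (rule Lim_null_comparison)
    show "((\<lambda>b. sqrt pi / b) \<longlongrightarrow> 0) at_top" by real_asymp
    show "\<forall>\<^sub>F b in at_top. cmod (of_real b * fresnel_phase b * I b) \<le> sqrt pi / b"
      using eventually_gt_at_top[of 0]
    proof eventually_elim
      case (elim b)
      have "cmod (of_real b * fresnel_phase b * I b) = b * cmod (I b)"
        using elim by (simp add: norm_mult norm_exp_i_times del: of_real_power)
      also have "\<dots> \<le> b * (sqrt pi / (2 * (b / sqrt 2)\<^sup>2))"
        using I(2)[OF elim] elim by (intro mult_left_mono) auto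
      also have "\<dots> = sqrt pi / b" using elim by (simp add: power_divide power2_eq_square)
      finally show ?case .
    qed
  qed
  then have "((\<lambda>b. (of_real b * fresnel_phase b * I b - of_real x * fresnel_phase x * J) / (2 * \<i> * of_real (sqrt pi)))
     \<longlongrightarrow> (0 - of_real x * fresnel_phase x * J) / (2 * \<i> * of_real (sqrt pi))) at_top"
    by (intro tendsto_intros) auto
  moreover have "\<forall>\<^sub>F b in at_top. (of_real b * fresnel_phase b * I b - of_real x * fresnel_phase x * J) / (2 * \<i> * of_real (sqrt pi))
      = integral {x..b} fresnel_phase"
    using eventually_ge_at_top[of x]
  proof eventually_elim
    case (elim b)
    have "b > 0" using elim \<open>x > 0\<close> by simp
    show ?case
      unfolding fresnel_integral_proper[OF \<open>x > 0\<close> elim J I(1)[OF \<open>b > 0\<close>], symmetric] by simp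
  qed
  moreover have "(0 - of_real x * fresnel_phase x * J) / (2 * \<i> * of_real (sqrt pi))
     = \<i> * of_real x * fresnel_phase x * J / (2 * of_real (sqrt pi))"
    by (simp add: field_simps)
  ultimately show ?thesis by (simp only: tendsto_cong)
qed

lemma fresnel_F_eq_kernel_integral:
  assumes "x > 0"
    and J: "((\<lambda>u. gauss_kernel (x / sqrt 2) (of_real u)) has_integral J) UNIV"
  shows "fresnel_F x = of_real (x / (2 * pi)) * exp (\<i> * of_real (x\<^sup>2 + pi / 4)) * J"
proof -
  have sqrt_pi: "complex_of_real (sqrt pi) * complex_of_real (sqrt pi) = complex_of_real pi"
    by (simp flip: of_real_mult)
  have "Lim at_top (\<lambda>b. integral {x..b} fresnel_phase)
     = \<i> * of_real x * fresnel_phase x * J / (2 * of_real (sqrt pi))"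
    by (rule tendsto_Lim[OF trivial_limit_at_top_linorder fresnel_integral_limit[OF assms]])
  then have "fresnel_F x = exp (- \<i> * of_real pi / 4) / of_real (sqrt pi)
      * (\<i> * of_real x * fresnel_phase x * J / (2 * of_real (sqrt pi)))"
    unfolding fresnel_F_def by simp
  also have "\<dots> = of_real (x / (2 * pi)) * (\<i> * exp (- \<i> * of_real pi / 4)) * fresnel_phase x * J"
    by (simp add: field_simps sqrt_pi)
  also have "\<i> * exp (- \<i> * of_real pi / 4) = exp (\<i> * of_real (pi / 4))"
  proof -
    have "\<i> = exp (\<i> * of_real (pi / 2))" by (simp only: cis_conv_exp[symmetric] cis_pi_half)
    then have "\<i> * exp (- \<i> * of_real pi / 4) = exp (\<i> * of_real (pi / 2) + - \<i> * of_real pi / 4)"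
      by (simp only: exp_add)
    also have "\<i> * of_real (pi / 2) + - \<i> * of_real pi / 4 = \<i> * of_real (pi / 4)" by simp
    finally show ?thesis .
  qed
  finally show ?thesis by (simp add: distrib_left exp_add mult_ac)
qed

lemma fresnel_integral_converges: "\<exists>L. ((\<lambda>b. integral {a..b} fresnel_phase) \<longlongrightarrow> L) at_top"
proof -
  define c where "c = max a 1"
  have c: "c > 0" "a \<le> c" by (auto simp: c_def)
  obtain J where "((\<lambda>u. gauss_kernel (c / sqrt 2) (of_real u)) has_integral J) UNIV"
    using gauss_kernel_has_integral[of "c / sqrt 2"] c by auto
  from fresnel_integral_limit[OF \<open>c > 0\<close> this]
  obtain L where "((\<lambda>b. integral {c..b} fresnel_phase) \<longlongrightarrow> L) at_top" by blast
  then have "((\<lambda>b. integral {a..c} fresnel_phase + integral {c..b} fresnel_phase)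
      \<longlongrightarrow> integral {a..c} fresnel_phase + L) at_top"
    by (intro tendsto_intros)
  moreover have "\<forall>\<^sub>F b in at_top. integral {a..c} fresnel_phase + integral {c..b} fresnel_phase = integral {a..b} fresnel_phase"
    using eventually_ge_at_top[of c]
    by eventually_elim (intro Henstock_Kurzweil_Integration.integral_combine c fresnel_phase_integrable)
  ultimately show ?thesis by (auto simp: tendsto_cong)
qed

lemma fresnel_F_diff:
  assumes "a \<le> c"
  shows "fresnel_F a - fresnel_F c
    = exp (- \<i> * of_real pi / 4) / of_real (sqrt pi) * integral {a..c} fresnel_phase"
proof -
  obtain L where L: "((\<lambda>b. integral {c..b} fresnel_phase) \<longlongrightarrow> L) at_top"
    using fresnel_integral_converges by blast
  then have "((\<lambda>b. integral {a..c} fresnel_phase + integral {c..b} fresnel_phase)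
      \<longlongrightarrow> integral {a..c} fresnel_phase + L) at_top"
    by (intro tendsto_intros)
  moreover have "\<forall>\<^sub>F b in at_top. integral {a..c} fresnel_phase + integral {c..b} fresnel_phase = integral {a..b} fresnel_phase"
    using eventually_ge_at_top[of c]
    by eventually_elim (intro Henstock_Kurzweil_Integration.integral_combine assms fresnel_phase_integrable)
  ultimately have "((\<lambda>b. integral {a..b} fresnel_phase) \<longlongrightarrow> integral {a..c} fresnel_phase + L) at_top"
    by (simp only: tendsto_cong)
  then have "Lim at_top (\<lambda>b. integral {a..b} fresnel_phase) = integral {a..c} fresnel_phase + L"
    by (intro tendsto_Lim) auto
  moreover have "Lim at_top (\<lambda>b. integral {c..b} fresnel_phase) = L"
    using L by (intro tendsto_Lim) auto
  ultimately show ?thesis unfolding fresnel_F_def by (simp add: algebra_simps)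
qed

lemma isCont_fresnel_F: "isCont fresnel_F x"
proof -
  let ?c = "exp (- \<i> * of_real pi / 4) / of_real (sqrt pi)"
  have "continuous_on {x - 1..x + 1} (\<lambda>y. fresnel_F (x - 1) - ?c * integral {x - 1..y} fresnel_phase)"
    by (intro continuous_intros indefinite_integral_continuous_1 fresnel_phase_integrable)
  moreover have "fresnel_F (x - 1) - ?c * integral {x - 1..y} fresnel_phase = fresnel_F y" if "y \<in> {x - 1..x + 1}" for y
    using fresnel_F_diff[of "x - 1" y] that by (simp add: algebra_simps)
  ultimately have "continuous_on {x - 1..x + 1} fresnel_F"
    by (simp cong: continuous_on_cong_simp)
  then show ?thesis
    by (rule continuous_on_interior) (simp add: interior_atLeastAtMost_real)
qed

text \<open>
  The phase is even, so \<open>F - F 0\<close> is odd.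
\<close>

lemma fresnel_F_minus: "fresnel_F (- x) = 2 * fresnel_F 0 - fresnel_F x"
proof -
  have *: "fresnel_F (- x) - fresnel_F 0 = fresnel_F 0 - fresnel_F x" if "x \<ge> 0" for x
  proof -
    have "integral {- x..0} fresnel_phase = integral {- x..- 0} (\<lambda>t. fresnel_phase (- t))" by simp
    also have "\<dots> = integral {0..x} fresnel_phase" by (rule Henstock_Kurzweil_Integration.integral_reflect_real)
    finally show ?thesis using fresnel_F_diff[of "- x" 0] fresnel_F_diff[of 0 x] that by simp
  qed
  show ?thesis
  proof (cases "x \<ge> 0")
    case True
    then show ?thesis using *[of x] by (simp add: algebra_simps)
  next
    case False
    then show ?thesis using *[of "- x"] by (simp add: algebra_simps)
  qed
qed

section \<open>Estimates on the shifted contour and for the truncation\<close>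

text \<open>
  For \<open>z = u + i v\<close> the Gaussian contributes \<open>v\<^sup>2 - u\<^sup>2\<close> and the weight \<open>- 2 A v\<close> to the exponent; the
  sum is \<open>(v - A)\<^sup>2 - A\<^sup>2 - u\<^sup>2\<close>, which as a function of \<open>v\<close> is smallest at \<open>v = A\<close>.
\<close>

lemma norm_kernel_weight_above:
  assumes "A > 0" "Im z \<ge> A" "D > 0" "D \<le> cmod (z - Complex y y) * cmod (z + Complex y y)"
  shows "cmod (gauss_kernel y z * midpoint_weight A z)
    \<le> exp (- A\<^sup>2) / (D * (1 - exp (- 2 * A\<^sup>2))) * exp ((Im z - A)\<^sup>2 - (Re z)\<^sup>2)"
proof -
  have E: "1 - exp (- 2 * A\<^sup>2) > 0" using assms by simp
  have "cmod (gauss_kernel y z) \<le> exp ((Im z)\<^sup>2 - (Re z)\<^sup>2) / D"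
    unfolding norm_gauss_kernel using assms by (intro divide_left_mono) auto
  moreover have "cmod (midpoint_weight A z) \<le> exp (- 2 * A * Im z) / (1 - exp (- 2 * A\<^sup>2))"
  proof -
    have "cmod (midpoint_weight A z) \<le> exp (- 2 * A * Im z) / (1 - exp (- 2 * A * Im z))"
      by (rule norm_midpoint_weight_le) (use assms in auto)
    also have "\<dots> \<le> exp (- 2 * A * Im z) / (1 - exp (- 2 * A\<^sup>2))"
    proof (rule divide_left_mono)
      have "A * A \<le> A * Im z" using assms by (intro mult_left_mono) auto
      then show *: "1 - exp (- 2 * A\<^sup>2) \<le> 1 - exp (- 2 * A * Im z)" by (simp add: power2_eq_square)
      show "0 < (1 - exp (- 2 * A * Im z)) * (1 - exp (- 2 * A\<^sup>2))" using * E by (intro mult_pos_pos) linarith+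
    qed auto
    finally show ?thesis .
  qed
  ultimately have "cmod (gauss_kernel y z * midpoint_weight A z)
     \<le> (exp ((Im z)\<^sup>2 - (Re z)\<^sup>2) / D) * (exp (- 2 * A * Im z) / (1 - exp (- 2 * A\<^sup>2)))"
    unfolding norm_mult using assms by (intro mult_mono) auto
  also have "\<dots> = exp ((Im z)\<^sup>2 - (Re z)\<^sup>2) * exp (- 2 * A * Im z) / (D * (1 - exp (- 2 * A\<^sup>2)))"
    by simp
  also have "exp ((Im z)\<^sup>2 - (Re z)\<^sup>2) * exp (- 2 * A * Im z)
      = exp (- A\<^sup>2) * exp ((Im z - A)\<^sup>2 - (Re z)\<^sup>2)"
    unfolding exp_add[symmetric] by (simp add: power2_eq_square algebra_simps)
  finally show ?thesis by simp
qed

lemma continuous_kernel_weight_path: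
  assumes "A > 0" "y > 0" "continuous_on I g" "\<And>u. u \<in> I \<Longrightarrow> Im (g u) > 0"
    "\<And>u. u \<in> I \<Longrightarrow> g u \<noteq> Complex y y"
  shows "continuous_on I (\<lambda>u. gauss_kernel y (g u) * midpoint_weight A (g u))"
proof (intro continuous_intros continuous_gauss_kernel continuous_midpoint_weight assms)
  fix u assume "u \<in> I"
  note Im = assms(4)[OF this]
  show "g u \<noteq> - Complex y y" using Im \<open>y > 0\<close> by (auto simp: complex_eq_iff)
  show "1 + exp (- 2 * \<i> * of_real A * g u) \<noteq> 0"
    by (rule weight_denominator_nonzero) (use Im \<open>A > 0\<close> in auto)
qed

lemma norm_line_integral_le:
  assumes "A > 0" "y > 0" "y \<noteq> A"
    and D: "D > 0" "\<And>u. u \<in> {a..b} \<Longrightarrow> D \<le> cmod (Complex u A - Complex y y) * cmod (Complex u A + Complex y y)"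
  shows "cmod (integral {a..b} (\<lambda>u. gauss_kernel y (Complex u A) * midpoint_weight A (Complex u A)))
    \<le> exp (- A\<^sup>2) / (D * (1 - exp (- 2 * A\<^sup>2))) * integral {a..b} (\<lambda>u. exp (- u\<^sup>2))"
proof -
  let ?C = "exp (- A\<^sup>2) / (D * (1 - exp (- 2 * A\<^sup>2)))"
  have "cmod (integral {a..b} (\<lambda>u. gauss_kernel y (Complex u A) * midpoint_weight A (Complex u A)))
    \<le> integral {a..b} (\<lambda>u. ?C * exp (- u\<^sup>2))"
  proof (rule Henstock_Kurzweil_Integration.integral_norm_bound_integral)
    show "(\<lambda>u. gauss_kernel y (Complex u A) * midpoint_weight A (Complex u A)) integrable_on {a..b}"
      by (intro integrable_continuous_real continuous_kernel_weight_path continuous_intros)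
        (use assms in auto)
    show "(\<lambda>u. ?C * exp (- u\<^sup>2)) integrable_on {a..b}"
      by (intro integrable_continuous_real continuous_intros)
    show "cmod (gauss_kernel y (Complex u A) * midpoint_weight A (Complex u A)) \<le> ?C * exp (- u\<^sup>2)"
      if "u \<in> {a..b}" for u
      using norm_kernel_weight_above[OF \<open>A > 0\<close> _ D(1) D(2)[OF that]] by simp
  qed
  then show ?thesis by simp
qed

text \<open>
  Since \<open>h A = \<pi>\<close>, squaring \<open>A + j h\<close> gives at least \<open>A\<^sup>2 + 2 \<pi> j\<close>, so the sum is dominated by a
  geometric series with ratio \<open>q = e\<^bsup>- 2 \<pi>\<^esup>\<close>. The inequality \<open>1 / (1 - q) \<le> 1 + 1 / (2 \<pi>)\<close> is
  \<open>1 + 2 \<pi> \<le> e\<^bsup>2 \<pi>\<^esup>\<close>.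
\<close>

lemma node_tail_sum_le:
  assumes "A > 0"
  shows "(\<Sum>j<m. exp (- (A + real j * pi / A)\<^sup>2)) \<le> (2 * pi + 1) / (2 * pi) * exp (- A\<^sup>2)"
proof -
  define q where "q = exp (- 2 * pi)"
  have q: "0 < q" "q < 1" by (auto simp: q_def)
  have "(\<Sum>j<m. exp (- (A + real j * pi / A)\<^sup>2)) \<le> (\<Sum>j<m. exp (- A\<^sup>2) * q ^ j)"
  proof (rule sum_mono)
    fix j
    have "A\<^sup>2 + real j * (2 * pi) \<le> (A + real j * pi / A)\<^sup>2"
      using assms by (simp add: power2_sum)
    then have "exp (- (A + real j * pi / A)\<^sup>2) \<le> exp (- A\<^sup>2 + real j * (- 2 * pi))" by simp
    also have "\<dots> = exp (- A\<^sup>2) * q ^ j" unfolding exp_add q_def exp_of_nat_mult ..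
    finally show "exp (- (A + real j * pi / A)\<^sup>2) \<le> exp (- A\<^sup>2) * q ^ j" .
  qed
  also have "\<dots> = exp (- A\<^sup>2) * ((1 - q ^ m) / (1 - q))"
    using q by (simp add: sum_distrib_left[symmetric] sum_gp_strict)
  also have "\<dots> \<le> exp (- A\<^sup>2) * (1 / (1 - q))"
    using q by (intro mult_left_mono divide_right_mono) auto
  also have "1 / (1 - q) \<le> (2 * pi + 1) / (2 * pi)"
  proof -
    have "2 * pi + 1 \<le> exp (2 * pi)" by (metis add.commute exp_ge_add_one_self)
    then have "(2 * pi + 1) * q \<le> 1"
      unfolding q_def by (simp add: exp_minus field_simps)
    then show ?thesis using q pi_gt_zero by (simp add: field_simps)
  qed
  finally show ?thesis by (simp add: mult.commute mult_left_mono)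
qed

lemma A_N_pos: "A_N N > 0"
  by (auto simp: A_N_def intro!: mult_pos_pos add_nonneg_pos)

lemma A_N_square: "(A_N N)\<^sup>2 = (real N + 1/2) * pi"
  unfolding A_N_def by (rule real_sqrt_pow2) auto

lemma t_node_eq_shifted_node: "t_node N k = shifted_node (A_N N) (int k)"
  by (simp add: t_node_def shifted_node_def)

text \<open>
  The definition of \<open>A_N\<close> makes the first omitted node equal to \<open>A_N N\<close>.
\<close>

lemma t_node_beyond: "t_node N (Suc N + j) = A_N N + real j * pi / A_N N"
proof -
  have "A_N N * A_N N = (real N + 1/2) * pi" using A_N_square by (simp add: power2_eq_square)
  then show ?thesis using A_N_pos[of N]
    by (simp add: t_node_def field_simps)
qed

lemma gauss_kernel_node:
  "gauss_kernel (x / sqrt 2) (of_real t) = of_real (exp (- t\<^sup>2)) / (of_real (x\<^sup>2) + \<i> * of_real (t\<^sup>2))"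
  unfolding gauss_kernel_def by (simp add: power_divide exp_of_real[symmetric])

lemma norm_node_tail_le:
  assumes "x > 0"
  shows "cmod (\<Sum>k=Suc N..n. of_real (exp (- (t_node N k)\<^sup>2)) / (of_real (x\<^sup>2) + \<i> * of_real ((t_node N k)\<^sup>2)))
    \<le> (2 * pi + 1) / (2 * pi) * exp (- (A_N N)\<^sup>2) / sqrt (x ^ 4 + A_N N ^ 4)"
proof -
  let ?A = "A_N N"
  have A: "?A > 0" by (rule A_N_pos)
  have s: "sqrt (x ^ 4 + ?A ^ 4) > 0" using assms A by (simp add: add_pos_pos)
  have "cmod (\<Sum>k=Suc N..n. of_real (exp (- (t_node N k)\<^sup>2)) / (of_real (x\<^sup>2) + \<i> * of_real ((t_node N k)\<^sup>2)))
     \<le> (\<Sum>k=Suc N..n. exp (- (t_node N k)\<^sup>2) / sqrt (x ^ 4 + ?A ^ 4))"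
  proof (rule sum_norm_le)
    fix k assume "k \<in> {Suc N..n}"
    then obtain j where "k = Suc N + j" by (metis atLeastAtMost_iff le_iff_add)
    then have "t_node N k \<ge> ?A" using A by (simp only: t_node_beyond) simp
    then have t: "?A ^ 4 \<le> (t_node N k) ^ 4" using A by (intro power_mono) auto
    have "cmod (of_real (x\<^sup>2) + \<i> * of_real ((t_node N k)\<^sup>2)) = sqrt (x ^ 4 + t_node N k ^ 4)"
      by (simp add: cmod_def flip: power_mult of_real_power)
    then have le: "sqrt (x ^ 4 + ?A ^ 4) \<le> cmod (of_real (x\<^sup>2) + \<i> * of_real ((t_node N k)\<^sup>2))"
      using t by simp
    then show "cmod (of_real (exp (- (t_node N k)\<^sup>2)) / (of_real (x\<^sup>2) + \<i> * of_real ((t_node N k)\<^sup>2)))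
      \<le> exp (- (t_node N k)\<^sup>2) / sqrt (x ^ 4 + ?A ^ 4)"
      unfolding norm_divide norm_of_real abs_exp_cancel
      by (intro divide_left_mono le mult_pos_pos s less_le_trans[OF s le] exp_ge_zero)
  qed
  also have "\<dots> = (\<Sum>k=Suc N..n. exp (- (t_node N k)\<^sup>2)) / sqrt (x ^ 4 + ?A ^ 4)"
    by (simp add: sum_divide_distrib)
  also have "(\<Sum>k=Suc N..n. exp (- (t_node N k)\<^sup>2)) = (\<Sum>j<Suc n - Suc N. exp (- (t_node N (Suc N + j))\<^sup>2))"
    by (rule sum.reindex_bij_witness[of _ "\<lambda>j. Suc N + j" "\<lambda>k. k - Suc N"]) auto
  also have "\<dots> \<le> (2 * pi + 1) / (2 * pi) * exp (- ?A\<^sup>2)"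
    unfolding t_node_beyond by (rule node_tail_sum_le[OF A])
  finally show ?thesis using s by (simp add: divide_right_mono)
qed

lemma symmetric_node_sum:
  "(\<Sum>k\<in>{1 - int n..int n}. gauss_kernel y (of_real (shifted_node A k)))
    = 2 * (\<Sum>k=1..n. gauss_kernel y (of_real (shifted_node A (int k))))"
proof -
  let ?f = "\<lambda>k. gauss_kernel y (of_real (shifted_node A k))"
  have "{1 - int n..int n} = {1..int n} \<union> {1 - int n..0}" by auto
  then have "(\<Sum>k\<in>{1 - int n..int n}. ?f k) = (\<Sum>k\<in>{1..int n}. ?f k) + (\<Sum>k\<in>{1 - int n..0}. ?f k)"
    by (simp only:) (rule sum.union_disjoint; auto)
  also have "(\<Sum>k\<in>{1..int n}. ?f k) = (\<Sum>k=1..n. ?f (int k))"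
    by (rule sum.reindex_bij_witness[of _ int nat]) auto
  also have "(\<Sum>k\<in>{1 - int n..0}. ?f k) = (\<Sum>k=1..n. ?f (int k))"
  proof (rule sum.reindex_bij_witness[of _ "\<lambda>k. 1 - int k" "\<lambda>k. nat (1 - k)"])
    fix k assume "k \<in> {1 - int n..0}"
    then have "real_of_int (int (nat (1 - k))) - 1/2 = - (real_of_int k - 1/2)" by simp
    then have "shifted_node A (int (nat (1 - k))) = - shifted_node A k"
      by (simp only: shifted_node_def mult_minus_left minus_divide_left)
    then show "?f (int (nat (1 - k))) = ?f k"
      by (simp add: gauss_kernel_minus)
  qed auto
  finally show ?thesis by simp
qed

lemma pole_eq_polar: "Complex (x / sqrt 2) (x / sqrt 2) = of_real x * exp (\<i> * of_real (pi / 4))"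
proof -
  have "Complex (x / sqrt 2) (x / sqrt 2) = of_real x * cis (pi / 4)"
    by (simp add: complex_eq_iff cos_45 sin_45 field_simps)
  then show ?thesis by (simp only: cis_conv_exp)
qed

lemma pole_square: "(Complex (x / sqrt 2) (x / sqrt 2))\<^sup>2 = \<i> * of_real (x\<^sup>2)"
  by (simp add: complex_eq_iff power2_eq_square)

lemma weight_at_pole:
  "midpoint_weight A (Complex (x / sqrt 2) (x / sqrt 2))
    = 1 / (exp (2 * of_real A * of_real x * exp (- \<i> * of_real pi / 4)) + 1)"
proof -
  have "- \<i> = exp (- (\<i> * of_real (pi / 2)))"
    using cis_conv_exp[of "- (pi/2)"] by (simp add: complex_eq_iff Re_exp Im_exp)
  then have "- \<i> * exp (\<i> * of_real (pi / 4)) = exp (- (\<i> * of_real (pi / 2)) + \<i> * of_real (pi / 4))"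
    by (simp only: exp_add)
  also have "- (\<i> * of_real (pi / 2)) + \<i> * of_real (pi / 4) = - \<i> * of_real pi / 4" by simp
  finally have *: "- \<i> * exp (\<i> * of_real (pi / 4)) = exp (- \<i> * of_real pi / 4)" .
  have "- 2 * \<i> * of_real A * (of_real x * exp (\<i> * of_real (pi / 4)))
      = 2 * of_real A * of_real x * (- \<i> * exp (\<i> * of_real (pi / 4)))" by simp
  then show ?thesis
    unfolding midpoint_weight_def pole_eq_polar * by (simp only: * add.commute)
qed

text \<open>
  With \<open>p = x e\<^bsup>i \<pi>/4\<^esup>\<close> and \<open>p\<^sup>2 = i x\<^sup>2\<close> every factor of the residue except the weight is cancelled
  by the prefactor of the integral representation.
\<close>

lemma pole_contribution:
  assumes "x > 0"
  defines "p \<equiv> Complex (x / sqrt 2) (x / sqrt 2)"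
  shows "of_real (x / (2 * pi)) * exp (\<i> * of_real (x\<^sup>2 + pi / 4)) * (2 * of_real pi * exp (- p\<^sup>2) / p * w) = w"
proof -
  have p0: "p \<noteq> 0" using assms by (simp add: complex_eq_iff)
  have "exp (\<i> * of_real (x\<^sup>2 + pi / 4)) * exp (- p\<^sup>2) = exp (\<i> * of_real (pi / 4))"
    unfolding exp_add[symmetric] p_def pole_square by (simp add: algebra_simps)
  then have "of_real x * (exp (\<i> * of_real (x\<^sup>2 + pi / 4)) * exp (- p\<^sup>2)) = p"
    by (simp add: p_def pole_eq_polar)
  moreover have "of_real (x / (2 * pi)) * exp (\<i> * of_real (x\<^sup>2 + pi / 4)) * (2 * of_real pi * exp (- p\<^sup>2) / p * w)
     = (of_real x * (exp (\<i> * of_real (x\<^sup>2 + pi / 4)) * exp (- p\<^sup>2))) / p * w"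
    by (simp add: field_simps)
  ultimately show ?thesis using p0 by simp
qed

section \<open>The error bound for positive arguments\<close>

text \<open>
  The reduction of the theorem to an estimate at height \<open>A\<close>. The approximation always contains
  the pole correction, but the contour identity yields it only for \<open>y < A\<close>; for \<open>y > A\<close> it is
  therefore subtracted from the line integral. The limit \<open>n \<rightarrow> \<infinity>\<close> removes the vertical sides.
\<close>

lemma fresnel_error_from_contour:
  fixes N :: nat and x rmin M :: real
  defines "A \<equiv> A_N N" and "y \<equiv> x / sqrt 2"
  defines "p \<equiv> Complex y y"
  defines "T \<equiv> \<lambda>r. integral {-r..r} (\<lambda>u. gauss_kernel y (Complex u A) * midpoint_weight A (Complex u A))"
  assumes "x > 0" "y \<noteq> A"
    and M: "\<And>r. r \<ge> rmin \<Longrightarrow>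
      cmod (2 * T r - (if y < A then 0 else 2 * of_real pi * exp (- p\<^sup>2) / p * midpoint_weight A p)) \<le> M"
  shows "cmod (fresnel_F x - fresnel_FN N x)
    \<le> x / (2 * pi) * M + (2 * pi + 1) * x / (2 * pi * A * sqrt (x ^ 4 + A ^ 4)) * exp (- A\<^sup>2)"
proof -
  have A: "A > 0" unfolding A_def by (rule A_N_pos)
  have y: "y > 0" using \<open>x > 0\<close> by (simp add: y_def)
  obtain J where J: "((\<lambda>u. gauss_kernel y (of_real u)) has_integral J) UNIV"
    using gauss_kernel_has_integral[OF y] by blast
  define I where "I = (\<lambda>r. integral {-r..r} (\<lambda>u. gauss_kernel y (of_real u)))"
  define r where "r = (\<lambda>n::nat. real n * pi / A)"
  define e where "e = exp (\<i> * of_real (x\<^sup>2 + pi / 4))"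
  define c where "c = of_real (x / (2 * pi)) * e"
  define a where "a = (\<lambda>k. complex_of_real (exp (- (t_node N k)\<^sup>2)) / (of_real (x\<^sup>2) + \<i> * of_real ((t_node N k)\<^sup>2)))"
  define g where "g = midpoint_weight A p"
  define Pg where "Pg = 2 * of_real pi * exp (- p\<^sup>2) / p * g"
  have a_eq: "gauss_kernel y (of_real (shifted_node A (int k))) = a k" for k
    unfolding a_def y_def A_def t_node_eq_shifted_node by (rule gauss_kernel_node)
  have ne: "cmod e = 1" unfolding e_def by (rule norm_exp_i_times)
  have nc: "cmod c = x / (2 * pi)" using \<open>x > 0\<close> by (simp add: c_def norm_mult norm_divide ne)
  have F: "fresnel_F x = c * J"
    unfolding c_def e_def using J unfolding y_def by (rule fresnel_F_eq_kernel_integral[OF \<open>x > 0\<close>])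
  have FN: "fresnel_FN N x = g + of_real (x / A) * e * (\<Sum>k=1..N. a k)"
    unfolding fresnel_FN_def g_def p_def y_def weight_at_pole e_def a_def A_def ..
  have cP: "c * Pg = g"
    unfolding c_def e_def Pg_def p_def y_def by (rule pole_contribution[OF \<open>x > 0\<close>])
  define tail where "tail = (2 * pi + 1) * x / (2 * pi * A * sqrt (x ^ 4 + A ^ 4)) * exp (- A\<^sup>2)"
  have bound: "cmod (fresnel_F x - fresnel_FN N x)
    \<le> x / (2 * pi) * cmod (J - I (r n)) + x / (2 * pi) * (6 * A * exp (A\<^sup>2 - (r n)\<^sup>2)) + x / (2 * pi) * M + tail"
    if "r n \<ge> rmin" "r n \<ge> y + 1" "n \<ge> N" for n
  proof -
    define S where "S = (\<Sum>k=1..n. a k)"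
    define R where "R = (\<Sum>k=Suc N..n. a k)"
    define E where "E = I (r n) - of_real (pi / A) * (2 * S) - 2 * T (r n) - (if y < A then Pg else 0)"
    define Q where "Q = 2 * T (r n) - (if y < A then 0 else Pg)"
    have E: "cmod E \<le> 6 * A * exp (A\<^sup>2 - (r n)\<^sup>2)"
      using midpoint_error_contour[OF A y \<open>y \<noteq> A\<close> r_def[THEN fun_cong] that(2)]
      unfolding symmetric_node_sum a_eq
      by (simp only: E_def I_def T_def S_def Pg_def g_def p_def)
    have Q: "cmod Q \<le> M" using M[OF that(1)] by (simp only: Q_def Pg_def g_def)
    have R: "cmod (of_real (x / A) * e * R) \<le> tail"
    proof -
      have "cmod (of_real (x / A) * e * R) = x / A * cmod R"
        using \<open>x > 0\<close> A by (simp add: norm_mult ne norm_divide)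
      also have "\<dots> \<le> x / A * ((2 * pi + 1) / (2 * pi) * exp (- A\<^sup>2) / sqrt (x ^ 4 + A ^ 4))"
        using norm_node_tail_le[OF \<open>x > 0\<close>, of N n] \<open>x > 0\<close> A
        unfolding R_def a_def A_def by (intro mult_left_mono) auto
      finally show ?thesis by (simp add: tail_def mult_ac)
    qed
    have SR: "(\<Sum>k=1..N. a k) = S - R"
    proof -
      have "{1..n} = {1..N} \<union> {Suc N..n}" using that(3) by auto
      then have "S = (\<Sum>k=1..N. a k) + R"
        unfolding S_def R_def by (simp only:) (rule sum.union_disjoint; auto)
      then show ?thesis by simp
    qed
    have cS: "c * (of_real (pi / A) * (2 * S)) = of_real (x / A) * e * S"
      using A by (simp add: c_def field_simps)
    \<comment> \<open>The five parts: cut-off of the integral, vertical sides, line integral, node sum, pole.\<close>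
    have split: "J = (J - I (r n)) + E + Q + of_real (pi / A) * (2 * S) + Pg"
      by (simp add: E_def Q_def)
    have cJ: "c * J = c * (J - I (r n)) + c * E + c * Q + c * (of_real (pi / A) * (2 * S)) + c * Pg"
      by (subst split) (simp only: distrib_left)
    have "fresnel_F x - fresnel_FN N x = c * (J - I (r n)) + c * E + c * Q + of_real (x / A) * e * R"
      unfolding F FN SR cJ cS cP by (simp add: right_diff_distrib)
    also have "cmod \<dots> \<le> x / (2 * pi) * cmod (J - I (r n)) + x / (2 * pi) * (6 * A * exp (A\<^sup>2 - (r n)\<^sup>2))
        + x / (2 * pi) * M + tail"
    proof (intro norm_triangle_le add_mono R)
      show "cmod (c * (J - I (r n))) \<le> x / (2 * pi) * cmod (J - I (r n))" by (simp only: norm_mult nc)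
      show "cmod (c * E) \<le> x / (2 * pi) * (6 * A * exp (A\<^sup>2 - (r n)\<^sup>2))" "cmod (c * Q) \<le> x / (2 * pi) * M"
        unfolding norm_mult nc using \<open>x > 0\<close> by (intro mult_left_mono E Q; simp)+
    qed
    finally show ?thesis .
  qed
  have r_top: "filterlim r at_top sequentially"
    unfolding r_def using A by real_asymp
  have "((\<lambda>n. I (r n)) \<longlongrightarrow> J) sequentially"
    unfolding I_def by (rule filterlim_compose[OF symmetric_integral_tendsto[OF J] r_top])
  then have 1: "(\<lambda>n. cmod (J - I (r n))) \<longlonglongrightarrow> cmod (J - J)"
    by (intro tendsto_intros)
  have 2: "(\<lambda>n. exp (A\<^sup>2 - (r n)\<^sup>2)) \<longlonglongrightarrow> 0"
  proof -
    have "((\<lambda>s. exp (A\<^sup>2 - s\<^sup>2)) \<longlongrightarrow> 0) at_top" by real_asymp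
    then show ?thesis by (rule filterlim_compose[OF _ r_top])
  qed
  have "(\<lambda>n. x / (2 * pi) * cmod (J - I (r n)) + x / (2 * pi) * (6 * A * exp (A\<^sup>2 - (r n)\<^sup>2)) + x / (2 * pi) * M + tail)
     \<longlonglongrightarrow> x / (2 * pi) * cmod (J - J) + x / (2 * pi) * (6 * A * 0) + x / (2 * pi) * M + tail"
    by (intro tendsto_intros 1 2)
  moreover have "\<forall>\<^sub>F n in sequentially. cmod (fresnel_F x - fresnel_FN N x)
    \<le> x / (2 * pi) * cmod (J - I (r n)) + x / (2 * pi) * (6 * A * exp (A\<^sup>2 - (r n)\<^sup>2)) + x / (2 * pi) * M + tail"
    using eventually_ge_at_top[of N] filterlim_at_top[THEN iffD1, OF r_top, rule_format, of rmin]
      filterlim_at_top[THEN iffD1, OF r_top, rule_format, of "y + 1"]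
    by eventually_elim (rule bound)
  ultimately have "cmod (fresnel_F x - fresnel_FN N x)
      \<le> x / (2 * pi) * cmod (J - J) + x / (2 * pi) * (6 * A * 0) + x / (2 * pi) * M + tail"
    by (intro tendsto_lowerbound[OF _ _ sequentially_bot]) auto
  then show ?thesis by (simp add: tail_def)
qed

text \<open>
  Both factors \<open>z - p\<close> and \<open>z + p\<close> are bounded below by their imaginary parts \<open>A - y\<close> and \<open>A + y\<close>.
  This is good unless \<open>y\<close> is close to \<open>A\<close>.
\<close>

lemma fresnel_error_away:
  fixes N :: nat and x :: real
  defines "A \<equiv> A_N N" and "y \<equiv> x / sqrt 2"
  assumes "x > 0" "y \<noteq> A"
  shows "cmod (fresnel_F x - fresnel_FN N x)
    \<le> x * exp (- A\<^sup>2) / (sqrt pi * \<bar>A\<^sup>2 - x\<^sup>2 / 2\<bar> * (1 - exp (- 2 * A\<^sup>2)))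
      + (if y < A then 0 else exp (- sqrt 2 * A * x) / (1 - exp (- sqrt 2 * A * x)))
      + (2 * pi + 1) * x / (2 * pi * A * sqrt (x ^ 4 + A ^ 4)) * exp (- A\<^sup>2)"
proof -
  have A: "A > 0" unfolding A_def by (rule A_N_pos)
  have y: "y > 0" using \<open>x > 0\<close> by (simp add: y_def)
  define p where "p = Complex y y"
  define D where "D = \<bar>A\<^sup>2 - y\<^sup>2\<bar>"
  define C where "C = exp (- A\<^sup>2) / (D * (1 - exp (- 2 * A\<^sup>2)))"
  define g where "g = midpoint_weight A p"
  define Pg where "Pg = 2 * of_real pi * exp (- p\<^sup>2) / p * g"
  define T where "T = (\<lambda>r. integral {-r..r} (\<lambda>u. gauss_kernel y (Complex u A) * midpoint_weight A (Complex u A)))"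
  have D: "D > 0" using \<open>y \<noteq> A\<close> A y by (simp add: D_def power2_eq_iff_nonneg)
  have C: "C \<ge> 0" using D A by (simp add: C_def)
  have D_le: "D \<le> cmod (Complex u A - Complex y y) * cmod (Complex u A + Complex y y)" for u
  proof -
    have "\<bar>A - y\<bar> * \<bar>A + y\<bar> \<le> cmod (Complex u A - Complex y y) * cmod (Complex u A + Complex y y)"
      using abs_Im_le_cmod[of "Complex u A - Complex y y"] abs_Im_le_cmod[of "Complex u A + Complex y y"]
      by (intro mult_mono) auto
    then show ?thesis by (simp add: D_def abs_mult[symmetric] square_diff_square_factored power2_eq_square mult.commute)
  qed
  have T: "cmod (T r) \<le> C * sqrt pi" for r
  proof -
    have "cmod (T r) \<le> C * integral {-r..r} (\<lambda>u. exp (- u\<^sup>2))"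
      unfolding T_def C_def by (rule norm_line_integral_le[OF A y \<open>y \<noteq> A\<close> D D_le])
    also have "\<dots> \<le> C * sqrt pi" using C gaussian_integral_le by (rule mult_left_mono[rotated])
    finally show ?thesis .
  qed
  have "cmod (fresnel_F x - fresnel_FN N x)
    \<le> x / (2 * pi) * (2 * (C * sqrt pi) + (if y < A then 0 else cmod Pg))
      + (2 * pi + 1) * x / (2 * pi * A * sqrt (x ^ 4 + A ^ 4)) * exp (- A\<^sup>2)"
  proof (rule fresnel_error_from_contour[where N = N and x = x,
        folded A_def y_def, folded p_def, folded g_def, folded Pg_def, OF \<open>x > 0\<close> \<open>y \<noteq> A\<close>])
    fix r
    have "cmod (2 * T r - (if y < A then 0 else Pg)) \<le> cmod (2 * T r) + cmod (if y < A then 0 else Pg)"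
      by (rule norm_triangle_ineq4)
    also have "\<dots> \<le> 2 * (C * sqrt pi) + (if y < A then 0 else cmod Pg)"
      using T[of r] by (simp add: norm_mult)
    finally show "cmod (2 * integral {-r..r} (\<lambda>u. gauss_kernel y (Complex u A) * midpoint_weight A (Complex u A))
        - (if y < A then 0 else Pg)) \<le> 2 * (C * sqrt pi) + (if y < A then 0 else cmod Pg)"
      by (simp add: T_def)
  qed
  moreover have "x / (2 * pi) * (2 * (C * sqrt pi))
      = x * exp (- A\<^sup>2) / (sqrt pi * \<bar>A\<^sup>2 - x\<^sup>2 / 2\<bar> * (1 - exp (- 2 * A\<^sup>2)))"
  proof -
    have "sqrt pi / pi = 1 / sqrt pi" by (simp add: field_simps)
    have "x / (2 * pi) * (2 * (C * sqrt pi)) = x * C * (sqrt pi / pi)" by simp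
    also have "\<dots> = x * exp (- A\<^sup>2) / (sqrt pi * D * (1 - exp (- 2 * A\<^sup>2)))"
      unfolding \<open>sqrt pi / pi = 1 / sqrt pi\<close> C_def by (simp add: mult_ac)
    finally show ?thesis by (simp add: D_def y_def power_divide)
  qed
  moreover have "x / (2 * pi) * cmod Pg \<le> exp (- sqrt 2 * A * x) / (1 - exp (- sqrt 2 * A * x))"
  proof -
    have "x / (2 * pi) * cmod Pg = cmod (of_real (x / (2 * pi)) * exp (\<i> * of_real (x\<^sup>2 + pi / 4)) * Pg)"
      using \<open>x > 0\<close> unfolding norm_mult norm_exp_i_times by (simp add: norm_divide)
    also have "\<dots> = cmod g"
      unfolding Pg_def p_def y_def by (subst pole_contribution[OF \<open>x > 0\<close>]) rule
    also have "\<dots> \<le> exp (- 2 * A * y) / (1 - exp (- 2 * A * y))"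
      using norm_midpoint_weight_le[of A p] A y by (simp add: g_def p_def)
    also have "- 2 * A * y = - sqrt 2 * A * x"
      by (simp add: y_def field_simps)
    finally show ?thesis .
  qed
  ultimately show ?thesis by (cases "y < A") (simp_all add: distrib_left)
qed

text \<open>
  On the indentation the horizontal distance \<open>u\<close> from the imaginary axis is larger than the height
  gained over \<open>A\<close>, so the Gaussian decay in \<open>u\<close> more than pays for leaving the optimal height. At
  the extreme corner the exponent is \<open>A\<^sup>2/2 - A y\<close>.
\<close>

lemma indentation_exponent:
  fixes A u v y :: real
  assumes "A > 0" "3/4 * A < y" "y < 5/4 * A" "A \<le> v" "v \<le> y + A / 4" "y - A / 4 \<le> u"
  shows "(v - A)\<^sup>2 - u\<^sup>2 \<le> - A\<^sup>2 / 4"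
proof -
  have "(v - A)\<^sup>2 \<le> (y - 3/4 * A)\<^sup>2" "(y - A / 4)\<^sup>2 \<le> u\<^sup>2"
    using assms by (auto intro: power_mono)
  then have "(v - A)\<^sup>2 - u\<^sup>2 \<le> (y - 3/4 * A)\<^sup>2 - (y - A / 4)\<^sup>2" by (rule diff_mono)
  also have "\<dots> = A\<^sup>2 / 2 - A * y" by (simp add: power2_eq_square algebra_simps)
  also have "\<dots> \<le> - A\<^sup>2 / 4"
  proof -
    have "A * (3/4 * A) \<le> A * y" using assms by (intro mult_left_mono) auto
    moreover have "A * (3/4 * A) = 3/4 * A\<^sup>2" by (simp add: power2_eq_square)
    ultimately show ?thesis by linarith
  qed
  finally show ?thesis .
qed

text \<open>
  The indentation has length at most \<open>3/2 A\<close>. The factor \<open>A\<close> is absorbed by the gap between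
  \<open>1/4\<close> and \<open>fresnel_beta\<close>; the values \<open>0.07\<close> and \<open>0.18 = 1/4 - 0.07\<close> split it conveniently.
\<close>

lemma indentation_constant:
  assumes "A > 0"
  shows "3/2 * A * exp (- A\<^sup>2 / 4) \<le> 2 * pi * exp (- fresnel_beta * A\<^sup>2)"
proof -
  have "sqrt 2 \<ge> 1.4" by (rule real_le_rsqrt) (simp add: power2_eq_square)
  then have beta: "fresnel_beta \<le> 0.07" unfolding fresnel_beta_def by (simp add: field_simps)
  have "A \<le> 4 * (1 + 0.18 * A\<^sup>2)"
  proof -
    have "0 \<le> (A - 1)\<^sup>2" by simp
    then show ?thesis using assms by (simp add: power2_eq_square algebra_simps)
  qed
  also have "1 + 0.18 * A\<^sup>2 \<le> exp (0.18 * A\<^sup>2)" by (rule exp_ge_add_one_self)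
  finally have "3/2 * A * exp (- A\<^sup>2 / 4) \<le> 3/2 * (4 * exp (0.18 * A\<^sup>2)) * exp (- A\<^sup>2 / 4)"
    by (intro mult_right_mono mult_left_mono) auto
  also have "\<dots> = 6 * (exp (0.18 * A\<^sup>2) * exp (- A\<^sup>2 / 4))" by simp
  also have "exp (0.18 * A\<^sup>2) * exp (- A\<^sup>2 / 4) = exp (- 0.07 * A\<^sup>2)"
    unfolding exp_add[symmetric] by (simp add: field_simps)
  also have "6 * exp (- 0.07 * A\<^sup>2) \<le> 2 * pi * exp (- fresnel_beta * A\<^sup>2)"
  proof (rule mult_mono)
    have "fresnel_beta * A\<^sup>2 \<le> 0.07 * A\<^sup>2" using beta by (intro mult_right_mono) auto
    then show "exp (- 0.07 * A\<^sup>2) \<le> exp (- fresnel_beta * A\<^sup>2)" by simp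
    show "6 \<le> 2 * pi" using pi_gt3 by simp
  qed auto
  finally show ?thesis .
qed

text \<open>
  The segment of the line within \<open>A/4\<close> of the pole is replaced by the other three sides of the
  rectangle \<open>[y - A/4, y + A/4] \<times> [A, y + A/4]\<close>. The deformed contour always passes above the pole:
  for \<open>y > A\<close> the rectangle contains \<open>p\<close>, and its residue supplies the missing pole term. Along the
  deformed contour the distance to \<open>p\<close> is at least \<open>A/4\<close> and the distance to \<open>-p\<close> at least \<open>A + y\<close>.
\<close>

lemma fresnel_error_near:
  fixes N :: nat and x :: real
  defines "A \<equiv> A_N N" and "y \<equiv> x / sqrt 2"
  assumes "x > 0" "y \<noteq> A" and near: "3/4 * A < y" "y < 5/4 * A"
  shows "cmod (fresnel_F x - fresnel_FN N x)
    \<le> 4 * x * exp (- A\<^sup>2) * (1 + 2 * sqrt pi * exp (- fresnel_beta * A\<^sup>2))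
          / (sqrt pi * A * (A + y) * (1 - exp (- 2 * A\<^sup>2)))
      + (2 * pi + 1) * x / (2 * pi * A * sqrt (x ^ 4 + A ^ 4)) * exp (- A\<^sup>2)"
proof -
  have A: "A > 0" unfolding A_def by (rule A_N_pos)
  have y: "y > 0" using \<open>x > 0\<close> by (simp add: y_def)
  define p where "p = Complex y y"
  define D where "D = A / 4 * (A + y)"
  define C where "C = exp (- A\<^sup>2) / (D * (1 - exp (- 2 * A\<^sup>2)))"
  define g where "g = midpoint_weight A p"
  define Pg where "Pg = 2 * of_real pi * exp (- p\<^sup>2) / p * g"
  define f where "f = (\<lambda>z. gauss_kernel y z * midpoint_weight A z)"
  define a where "a = y - A / 4"
  define b where "b = y + A / 4"
  define G where "G = (\<lambda>s t. integral {s..t} (\<lambda>u::real. exp (- u\<^sup>2)))"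
  define q where "q = exp (- A\<^sup>2 / 4)"
  have D: "D > 0" using A y by (simp add: D_def)
  have C: "C \<ge> 0" using D A by (simp add: C_def)
  have ab: "a < b" "A < b" "b - A \<le> A / 2" "b - a = A / 2" using A near by (auto simp: a_def b_def)
  have p0: "p \<noteq> 0" using y by (simp add: p_def complex_eq_iff)
  have D_le: "D \<le> cmod (z - Complex y y) * cmod (z + Complex y y)"
    if "Im z \<ge> A" "\<bar>Re z - y\<bar> \<ge> A / 4 \<or> Im z - y \<ge> A / 4" for z
  proof -
    have "A / 4 \<le> cmod (z - Complex y y)"
      using that(2) abs_Re_le_cmod[of "z - Complex y y"] abs_Im_le_cmod[of "z - Complex y y"] by auto
    moreover have "A + y \<le> cmod (z + Complex y y)"
      using that(1) abs_Im_le_cmod[of "z + Complex y y"] by auto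
    ultimately show ?thesis unfolding D_def using A y by (intro mult_mono) auto
  qed
  have line: "cmod (integral {s..t} (\<lambda>u. f (Complex u A))) \<le> C * G s t"
    if "t \<le> a \<or> b \<le> s" for s t
    unfolding f_def C_def G_def
  proof (rule norm_line_integral_le[OF A y \<open>y \<noteq> A\<close> D])
    fix u assume "u \<in> {s..t}"
    then have "u \<le> y - A / 4 \<or> y + A / 4 \<le> u" using that by (auto simp: a_def b_def)
    then have "\<bar>u - y\<bar> \<ge> A / 4" by linarith
    then show "D \<le> cmod (Complex u A - Complex y y) * cmod (Complex u A + Complex y y)"
      by (intro D_le) auto
  qed
  have bump: "cmod (f z) \<le> C * q"
    if "A \<le> Im z" "Im z \<le> b" "a \<le> Re z" "\<bar>Re z - y\<bar> \<ge> A / 4 \<or> Im z - y \<ge> A / 4" for z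
  proof -
    have "cmod (f z) \<le> C * exp ((Im z - A)\<^sup>2 - (Re z)\<^sup>2)"
      unfolding f_def C_def by (rule norm_kernel_weight_above[OF A that(1) D D_le[OF that(1,4)]])
    also have "\<dots> \<le> C * q"
      unfolding q_def using indentation_exponent[OF A near, of "Im z" "Re z"] that C
      by (intro mult_left_mono) (auto simp: a_def b_def)
    finally show ?thesis .
  qed
  have contf: "continuous_on I (\<lambda>u. f (h u))"
    if "continuous_on I h" "\<And>u. u \<in> I \<Longrightarrow> Im (h u) > 0" "\<And>u. u \<in> I \<Longrightarrow> h u \<noteq> p" for I :: "real set" and h
    unfolding f_def by (rule continuous_kernel_weight_path) (use that A y in \<open>auto simp: p_def\<close>)
  define U where "U = integral {a..b} (\<lambda>u. f (Complex u b))"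
  define L where "L = integral {A..b} (\<lambda>v. f (Complex a v))"
  define R where "R = integral {A..b} (\<lambda>v. f (Complex b v))"
  have U: "cmod U \<le> C * q * (b - a)" unfolding U_def
    by (rule integral_bound) (use ab A in \<open>auto intro!: contf bump continuous_intros simp: p_def b_def\<close>)
  have L: "cmod L \<le> C * q * (b - A)" unfolding L_def
    by (rule integral_bound) (use ab A in \<open>auto intro!: contf bump continuous_intros simp: p_def a_def complex_eq_iff\<close>)
  have R: "cmod R \<le> C * q * (b - A)" unfolding R_def
    by (rule integral_bound) (use ab A in \<open>auto intro!: contf bump continuous_intros simp: p_def a_def b_def complex_eq_iff\<close>)
  have rect: "integral {a..b} (\<lambda>u. f (Complex u A)) + \<i> * R - U - \<i> * L = (if y < A then 0 else Pg / 2)"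
  proof -
    define P where "P = (if y < A then {} else {p})"
    define S where "S = {z. Im z > (if y < A then y else 0)}"
    have "integral {a..b} (\<lambda>u. f (Complex u A)) + \<i> * R - U - \<i> * L
        = 2 * of_real pi * \<i> * (\<Sum>p\<in>P. residue f p)"
      unfolding R_def U_def L_def
    proof (rule rectangle_residue[where S = S])
      show "open S" unfolding S_def by (intro open_Collect_less continuous_intros)
      have "convex S" unfolding S_def by (rule convex_halfspace_Im_gt)
      then show "connected S" by (rule convex_connected)
      show "cbox (Complex a A) (Complex b b) \<subseteq> S"
        using A by (auto simp: S_def in_cbox_complex_iff)
      show "P \<subseteq> box (Complex a A) (Complex b b)"
        using A \<open>y \<noteq> A\<close> by (auto simp: P_def p_def a_def b_def in_box_complex_iff)
      have "gauss_kernel y holomorphic_on S - P"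
        by (rule gauss_kernel_holomorphic) (use y in \<open>auto simp: S_def P_def p_def\<close>)
      moreover have "1 + exp (- 2 * \<i> * of_real A * z) \<noteq> 0" if "z \<in> S - P" for z
        by (rule weight_denominator_nonzero[OF A]) (use that y in \<open>auto simp: S_def split: if_splits\<close>)
      ultimately show "f holomorphic_on S - P"
        unfolding f_def midpoint_weight_def by (intro holomorphic_intros) auto
    qed (use ab in \<open>auto simp: P_def\<close>)
    also have "(\<Sum>p\<in>P. residue f p) = (if y < A then 0 else exp (- p\<^sup>2) / (2 * \<i> * p) * g)"
      using residue_kernel_weight_pole[OF A y, of p] by (simp add: P_def f_def p_def g_def)
    finally show ?thesis using p0 by (simp add: Pg_def field_simps)
  qed
  have "cmod (fresnel_F x - fresnel_FN N x)
    \<le> x / (2 * pi) * (2 * (C * (sqrt pi + 3/2 * A * q)))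
      + (2 * pi + 1) * x / (2 * pi * A * sqrt (x ^ 4 + A ^ 4)) * exp (- A\<^sup>2)"
  proof (rule fresnel_error_from_contour[where N = N and x = x and rmin = b,
        folded A_def y_def, folded p_def, folded g_def, folded Pg_def, OF \<open>x > 0\<close> \<open>y \<noteq> A\<close>])
    fix r assume "b \<le> r"
    have a0: "a > 0" using near A by (simp add: a_def)
    have r: "- r \<le> a" "a \<le> b" "b \<le> r" "a \<le> r" using \<open>b \<le> r\<close> ab a0 by auto
    have int: "(\<lambda>u. f (Complex u A)) integrable_on {s..t}" for s t
      by (intro integrable_continuous_real contf continuous_intros)
         (use A \<open>y \<noteq> A\<close> in \<open>auto simp: p_def\<close>)
    have intG: "(\<lambda>u::real. exp (- u\<^sup>2)) integrable_on {s..t}" for s t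
      by (intro integrable_continuous_real continuous_intros)
    have "integral {-r..r} (\<lambda>u. f (Complex u A)) = integral {-r..a} (\<lambda>u. f (Complex u A))
        + integral {a..b} (\<lambda>u. f (Complex u A)) + integral {b..r} (\<lambda>u. f (Complex u A))"
      unfolding Henstock_Kurzweil_Integration.integral_combine[OF r(1,4) int, symmetric]
        Henstock_Kurzweil_Integration.integral_combine[OF r(2,3) int, symmetric] by simp
    moreover have "integral {a..b} (\<lambda>u. f (Complex u A)) = (if y < A then 0 else Pg / 2) + U + \<i> * L - \<i> * R"
      unfolding rect[symmetric] by simp
    ultimately have eq: "2 * integral {-r..r} (\<lambda>u. f (Complex u A)) - (if y < A then 0 else Pg)
        = 2 * (integral {-r..a} (\<lambda>u. f (Complex u A)) + integral {b..r} (\<lambda>u. f (Complex u A)) + U + \<i> * L - \<i> * R)"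
      by simp
    have "G (-r) a + G b r \<le> sqrt pi"
    proof -
      have "G (-r) r = G (-r) a + G a b + G b r" unfolding G_def
        using Henstock_Kurzweil_Integration.integral_combine[OF _ _ intG[of "-r" r], of a]
          Henstock_Kurzweil_Integration.integral_combine[OF _ _ intG[of a r], of b] r by simp
      moreover have "G a b \<ge> 0" unfolding G_def by (intro Henstock_Kurzweil_Integration.integral_nonneg intG) auto
      moreover have "G (-r) r \<le> sqrt pi" unfolding G_def by (rule gaussian_integral_le)
      ultimately show ?thesis by simp
    qed
    then have CG: "C * G (-r) a + C * G b r \<le> C * sqrt pi"
      unfolding distrib_left[symmetric] using C by (rule mult_left_mono)
    have "cmod (integral {-r..a} (\<lambda>u. f (Complex u A)) + integral {b..r} (\<lambda>u. f (Complex u A)) + U + \<i> * L - \<i> * R)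
      \<le> C * G (-r) a + C * G b r + C * q * (b - a) + C * q * (b - A) + C * q * (b - A)"
      by (intro norm_triangle_le norm_triangle_le_diff add_mono)
         (use line[of a "-r"] line[of r b] U L R in \<open>auto simp: norm_mult\<close>)
    also have "\<dots> \<le> C * sqrt pi + C * q * (A / 2) + C * q * (A / 2) + C * q * (A / 2)"
      using CG ab C by (intro add_mono mult_left_mono) (auto simp: q_def)
    also have "\<dots> = C * (sqrt pi + 3/2 * A * q)" by (simp add: algebra_simps)
    finally show "cmod (2 * integral {-r..r} (\<lambda>u. gauss_kernel y (Complex u A) * midpoint_weight A (Complex u A))
        - (if y < A then 0 else Pg)) \<le> 2 * (C * (sqrt pi + 3/2 * A * q))"
      using eq unfolding f_def by (simp only: norm_mult norm_numeral)
  qed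
  moreover have "x / (2 * pi) * (2 * (C * (sqrt pi + 3/2 * A * q)))
      \<le> x / (2 * pi) * (2 * (C * (sqrt pi + 2 * pi * exp (- fresnel_beta * A\<^sup>2))))"
    using indentation_constant[OF A] \<open>x > 0\<close> C by (intro mult_left_mono add_left_mono) (auto simp: q_def)
  moreover have "x / (2 * pi) * (2 * (C * (sqrt pi + 2 * pi * exp (- fresnel_beta * A\<^sup>2))))
     = 4 * x * exp (- A\<^sup>2) * (1 + 2 * sqrt pi * exp (- fresnel_beta * A\<^sup>2))
          / (sqrt pi * A * (A + y) * (1 - exp (- 2 * A\<^sup>2)))"
  proof -
    have sp: "pi = sqrt pi * sqrt pi" by simp
    have "sqrt pi + 2 * pi * exp (- fresnel_beta * A\<^sup>2) = sqrt pi * (1 + 2 * sqrt pi * exp (- fresnel_beta * A\<^sup>2))"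
      by (subst (2) sp) (simp only: distrib_left mult_1_right mult_ac)
    then have "x / (2 * pi) * (2 * (C * (sqrt pi + 2 * pi * exp (- fresnel_beta * A\<^sup>2))))
        = x * C * (sqrt pi / pi) * (1 + 2 * sqrt pi * exp (- fresnel_beta * A\<^sup>2))"
      by simp
    also have "sqrt pi / pi = 1 / sqrt pi" by (simp add: field_simps)
    finally show ?thesis by (simp add: C_def D_def mult_ac)
  qed
  ultimately show ?thesis by linarith
qed

lemma weight_denominator_at_pole:
  "exp (2 * of_real (A_N N) * of_real x * exp (- \<i> * of_real pi / 4)) + 1 \<noteq> 0"
proof (cases "x = 0")
  case False
  have "Im (Complex (x / sqrt 2) (x / sqrt 2)) \<noteq> 0" using False by simp
  from weight_denominator_nonzero[OF A_N_pos[of N] this]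
  show ?thesis using weight_at_pole[of "A_N N" x] unfolding midpoint_weight_def
    by (metis add.commute div_by_0 divide_eq_0_iff one_neq_zero)
qed simp

text \<open>
  The pole correction is \<open>1 / (e\<^sup>w + 1)\<close> with \<open>w\<close> odd in \<open>x\<close>, and the node sum is odd in \<open>x\<close>.
\<close>

lemma fresnel_FN_minus: "fresnel_FN N (- x) = 1 - fresnel_FN N x"
proof -
  let ?w = "2 * of_real (A_N N) * of_real x * exp (- \<i> * of_real pi / 4)"
  let ?s = "of_real (x / A_N N) * exp (\<i> * of_real (x\<^sup>2 + pi / 4)) *
       (\<Sum>k=1..N. of_real (exp (- (t_node N k)\<^sup>2)) / (of_real (x\<^sup>2) + \<i> * of_real ((t_node N k)\<^sup>2)))"
  have nz: "exp ?w + 1 \<noteq> 0" by (rule weight_denominator_at_pole)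
  have "1 / (exp (- ?w) + 1) = 1 - 1 / (exp ?w + 1)"
  proof -
    have "1 / (exp (- ?w) + 1) = exp ?w / (exp ?w + 1)"
      using nz exp_not_eq_zero[of ?w] by (simp add: exp_minus field_simps del: exp_not_eq_zero)
    then show ?thesis using nz by (simp add: field_simps)
  qed
  moreover have "fresnel_FN N (- x) = 1 / (exp (- ?w) + 1) - ?s"
    by (simp add: fresnel_FN_def)
  moreover have "fresnel_FN N x = 1 / (exp ?w + 1) + ?s"
    by (simp add: fresnel_FN_def)
  ultimately show ?thesis by simp
qed

section \<open>Continuity arguments and the theorem\<close>

lemma isCont_fresnel_FN: "isCont (fresnel_FN N) x"
proof -
  have "t_node N k \<noteq> 0" for k
  proof -
    have "real k \<noteq> 1/2"
    proof
      assume "real k = 1/2"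
      then have "real (2 * k) = real 1" by simp
      then have "2 * k = 1" by (simp only: of_nat_eq_iff)
      then show False by presburger
    qed
    then show ?thesis using A_N_pos[of N] by (simp add: t_node_def)
  qed
  then have "complex_of_real (x\<^sup>2) + \<i> * of_real ((t_node N k)\<^sup>2) \<noteq> 0" for k
    by (simp add: complex_eq_iff)
  moreover have "A_N N \<noteq> 0" using A_N_pos[of N] by simp
  ultimately show ?thesis
    unfolding fresnel_FN_def by (intro continuous_intros weight_denominator_at_pole)
qed

lemma isCont_le_at_right:
  fixes f g :: "real \<Rightarrow> real"
  assumes "isCont f a" "isCont g a" "\<forall>\<^sub>F x in at_right a. f x \<le> g x"
  shows "f a \<le> g a"
proof -
  have "(f \<longlongrightarrow> f a) (at_right a)" "(g \<longlongrightarrow> g a) (at_right a)"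
    using assms(1,2) unfolding isCont_def by (meson at_le subset_UNIV tendsto_mono)+
  then show ?thesis using assms(3) by (intro tendsto_le[of "at_right a" g _ f]) auto
qed

lemma fresnel_error_pos_generic:
  assumes "x > 0" "x / sqrt 2 \<noteq> A_N N"
  shows "cmod (fresnel_F x - fresnel_FN N x) \<le> fresnel_eta N x"
proof -
  define A where "A = A_N N"
  define y where "y = x / sqrt 2"
  have A: "A > 0" unfolding A_def by (rule A_N_pos)
  have y: "y > 0" "y\<^sup>2 = x\<^sup>2 / 2" using \<open>x > 0\<close> by (auto simp: y_def power_divide)
  note away = fresnel_error_away[OF assms, folded A_def y_def]
  consider "y \<le> 3/4 * A" | "3/4 * A < y" "y < 5/4 * A" | "5/4 * A \<le> y" by linarith
  then show ?thesis
  proof cases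
    case 1
    have "y\<^sup>2 \<le> A\<^sup>2" using 1 y A by (intro power_mono) auto
    then have "\<bar>A\<^sup>2 - x\<^sup>2 / 2\<bar> = A\<^sup>2 - x\<^sup>2 / 2" using y by simp
    then show ?thesis using away 1 \<open>x > 0\<close> A
      by (simp add: fresnel_eta_def fresnel_Delta_def flip: A_def y_def)
  next
    case 2
    then show ?thesis
      using fresnel_error_near[OF assms, folded A_def y_def] \<open>x > 0\<close>
      by (simp add: fresnel_eta_def fresnel_Delta_def flip: A_def y_def)
  next
    case 3
    have "A\<^sup>2 \<le> y\<^sup>2" using 3 y A by (intro power_mono) auto
    then have "\<bar>A\<^sup>2 - x\<^sup>2 / 2\<bar> = x\<^sup>2 / 2 - A\<^sup>2" using y by simp
    then show ?thesis using away 3 \<open>x > 0\<close> A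
      by (simp add: fresnel_eta_def fresnel_Delta_def flip: A_def y_def)
  qed
qed

text \<open>
  When the pole lies exactly on the line, neither contour is available. Both sides of the middle
  estimate are continuous there, so it extends from arguments slightly to the right.
\<close>

lemma fresnel_error_pos:
  assumes "x > 0"
  shows "cmod (fresnel_F x - fresnel_FN N x) \<le> fresnel_eta N x"
proof (cases "x / sqrt 2 = A_N N")
  case True
  define A where "A = A_N N"
  have A: "A > 0" unfolding A_def by (rule A_N_pos)
  have x: "x = sqrt 2 * A" using True by (simp add: A_def field_simps)
  define g where "g = (\<lambda>x. 4 * x * exp (- A\<^sup>2) * (1 + 2 * sqrt pi * exp (- fresnel_beta * A\<^sup>2))
          / (sqrt pi * A * (A + x / sqrt 2) * (1 - exp (- 2 * A\<^sup>2)))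
      + (2 * pi + 1) * x / (2 * pi * A * sqrt (x ^ 4 + A ^ 4)) * exp (- A\<^sup>2))"
  have "cmod (fresnel_F x - fresnel_FN N x) \<le> g x"
  proof (rule isCont_le_at_right[where a = x and f = "\<lambda>x. cmod (fresnel_F x - fresnel_FN N x)" and g = g])
    show "isCont (\<lambda>x. cmod (fresnel_F x - fresnel_FN N x)) x"
      by (intro continuous_intros isCont_fresnel_F isCont_fresnel_FN)
    have "A + x / sqrt 2 > 0" "x ^ 4 + A ^ 4 > 0" "1 - exp (- 2 * A\<^sup>2) > 0"
      using A \<open>x > 0\<close> by (simp_all add: add_pos_pos)
    then show "isCont g x"
      unfolding g_def using A by (intro continuous_intros) auto
    have "\<forall>\<^sub>F z in at_right x. z \<in> {x<..<5/4 * x}"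
      using \<open>x > 0\<close> by (intro eventually_at_right_real) auto
    then show "\<forall>\<^sub>F z in at_right x. cmod (fresnel_F z - fresnel_FN N z) \<le> g z"
    proof eventually_elim
      case (elim z)
      then have z: "A < z / sqrt 2" "z / sqrt 2 < 5/4 * A" by (auto simp: x field_simps)
      have "z > 0" using elim \<open>x > 0\<close> by simp
      moreover have "z / sqrt 2 \<noteq> A_N N" using z(1) unfolding A_def by (rule less_imp_neq[symmetric])
      moreover have "3/4 * A_N N < z / sqrt 2" using z(1) A unfolding A_def by linarith
      moreover have "z / sqrt 2 < 5/4 * A_N N" using z(2) unfolding A_def .
      ultimately show ?case unfolding g_def A_def by (rule fresnel_error_near)
    qed
  qed
  also have "g x = fresnel_eta N x"
  proof -
    have d: "\<bar>x\<bar> = x" "x / sqrt 2 = A" using True \<open>x > 0\<close> by (simp_all add: A_def)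
    have "(A \<le> 3/4 * A) = False" "(A < 5/4 * A) = True" using A by auto
    then show ?thesis
      unfolding g_def fresnel_eta_def fresnel_Delta_def A_def[symmetric] d by (simp only: if_True if_False)
  qed
  finally show ?thesis .
qed (rule fresnel_error_pos_generic[OF assms])

text \<open>
  The classical value follows from the error bound itself: any one of the approximations has the
  value \<open>1/2\<close> at \<open>0\<close> and its error bound vanishes as \<open>x \<rightarrow> 0\<close>. The approximation with no nodes
  serves.
\<close>

lemma fresnel_F_0: "fresnel_F 0 = 1 / 2"
proof -
  define A where "A = A_N 0"
  have A: "A > 0" unfolding A_def by (rule A_N_pos)
  define g where "g = (\<lambda>x. x * exp (- A\<^sup>2) / (sqrt pi * (A\<^sup>2 - x\<^sup>2 / 2) * (1 - exp (- 2 * A\<^sup>2)))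
      + (2 * pi + 1) * x / (2 * pi * A * sqrt (x ^ 4 + A ^ 4)) * exp (- A\<^sup>2))"
  have "cmod (fresnel_F 0 - fresnel_FN 0 0) \<le> g 0"
  proof (rule isCont_le_at_right[where a = 0 and f = "\<lambda>x. cmod (fresnel_F x - fresnel_FN 0 x)" and g = g])
    show "isCont (\<lambda>x. cmod (fresnel_F x - fresnel_FN 0 x)) 0"
      by (intro continuous_intros isCont_fresnel_F isCont_fresnel_FN)
    show "isCont g 0"
      unfolding g_def using A by (intro continuous_intros) auto
    have "\<forall>\<^sub>F z in at_right 0. z \<in> {0<..<3/4 * A}"
      using A by (intro eventually_at_right_real) auto
    then show "\<forall>\<^sub>F z in at_right 0. cmod (fresnel_F z - fresnel_FN 0 z) \<le> g z"
    proof eventually_elim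
      case (elim z)
      have "z / sqrt 2 \<le> z" using elim by (simp add: field_simps)
      moreover have "z < 3/4 * A" using elim by simp
      ultimately have "z / sqrt 2 \<le> 3/4 * A" by linarith
      then have "fresnel_eta 0 z = g z"
        using elim by (simp add: g_def fresnel_eta_def fresnel_Delta_def flip: A_def)
      then show ?case using fresnel_error_pos[of z 0] elim by simp
    qed
  qed
  then show ?thesis by (simp add: g_def fresnel_FN_def)
qed

theorem theorem2:
  fixes N :: nat and x :: real
  assumes "N \<ge> 1"
  shows "cmod (fresnel_F x - fresnel_FN N x) \<le> fresnel_eta N x"
proof -
  consider "x > 0" | "x = 0" | "x < 0" by linarith
  then show ?thesis
  proof cases
    case 1
    then show ?thesis by (rule fresnel_error_pos)
  next
    case 2
    then show ?thesis
      using A_N_pos[of N] by (simp add: fresnel_F_0 fresnel_FN_def fresnel_eta_def fresnel_Delta_def)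
  next
    case 3
    have "fresnel_F x - fresnel_FN N x = - (fresnel_F (- x) - fresnel_FN N (- x))"
      unfolding fresnel_F_minus fresnel_FN_minus by (simp add: fresnel_F_0)
    then have "cmod (fresnel_F x - fresnel_FN N x) = cmod (fresnel_F (- x) - fresnel_FN N (- x))"
      by (simp only: norm_minus_cancel)
    also have "\<dots> \<le> fresnel_eta N (- x)" using 3 by (intro fresnel_error_pos) simp
    also have "\<dots> = fresnel_eta N x" by (simp add: fresnel_eta_def)
    finally show ?thesis .
  qed
qed

end
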